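(* Let $\mathcal M$ be a $\mathcal{C}^{(3)}$-smooth embedded submanifold of $\mathbb{R}^n$, $C\subseteq\mathcal M$ and $\bar x\in C$. If $C$ is amenable at $\bar x$ in $\mathcal M$, then $C$ is smoothly approximately convex at $\bar x$ in $\mathcal M$.
   Context: $d_{\mathcal M}$ is the Riemannian (intrinsic) distance on $\mathcal M$. Amenable in $\mathcal M$: there are an open neighborhood $V$ of $\bar x$ in $\mathcal M$, a $\mathcal{C}^{(1)}$ map $F:V\to\mathbb{R}^m$ and a closed convex $D\subseteq\mathbb{R}^m$ with $C\cap V=\{x\in V:F(x)\in D\}$ such that the only $y\in N_D(F(\bar x))=\{y:\langle y,d-F(\bar x)\rangle\le0\ \forall d\in D\}$ with $y\perp\mathrm{Range}(dF(\bar x))$ is $y=0$, where $dF(\bar x):T_{\mathcal M}(\bar x)\to\mathbb{R}^m$ is the differential. An averaging map from $x$ to $x'$ is a curve $g:[0,1]\to\mathcal M$, $g(0)=x,g(1)=x'$, with $d_{\mathcal M}(g(t_1),g(t_2))=|t_1-t_2|d_{\mathcal M}(x,x')$; near $\bar x$ it exists and is unique. A smooth curve segment in $C$ is a curve $\gamma:[0,1]\to C$ extending to a $\mathcal{C}^{(1)}$ map on an open neighborhood of $[0,1]$. Smoothly approximately convex at $\bar x$ in $\mathcal M$: for every $\epsilon>0$ there is a neighborhood $W$ of $\bar x$ such that any distinct $x,x'\in C\cap W$ are joined by a smooth curve segment $\gamma$ in $C$ from $x$ to $x'$ with $\|\gamma'(t)-g'(t)\|\le\epsilon\, d_{\mathcal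 M}(x,x')$ for all $t\in[0,1]$, $g$ the averaging map from $x$ to $x'$. *)

theory Defs
  imports "HOL-Analysis.Analysis"
begin

definition C1_on :: "'a::real_normed_vector set \<Rightarrow> ('a \<Rightarrow> 'b::real_normed_vector) \<Rightarrow> bool" where
  "C1_on U f \<longleftrightarrow> (\<exists>f' :: 'a \<Rightarrow> ('a \<Rightarrow>\<^sub>L 'b).
      (\<forall>x\<in>U. (f has_derivative blinfun_apply (f' x)) (at x)) \<and> continuous_on U f')"

definition C2_on :: "'a::real_normed_vector set \<Rightarrow> ('a \<Rightarrow> 'b::real_normed_vector) \<Rightarrow> bool" where
  "C2_on U f \<longleftrightarrow> (\<exists>f' :: 'a \<Rightarrow> ('a \<Rightarrow>\<^sub>L 'b).
      (\<forall>x\<in>U. (f has_derivative blinfun_apply (f' x)) (at x)) \<and> C1_on U f')"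

definition C3_on :: "'a::real_normed_vector set \<Rightarrow> ('a \<Rightarrow> 'b::real_normed_vector) \<Rightarrow> bool" where
  "C3_on U f \<longleftrightarrow> (\<exists>f' :: 'a \<Rightarrow> ('a \<Rightarrow>\<^sub>L 'b).
      (\<forall>x\<in>U. (f has_derivative blinfun_apply (f' x)) (at x)) \<and> C2_on U f')"

definition C3_embedded_submanifold :: "'a::euclidean_space set \<Rightarrow> bool" where
  "C3_embedded_submanifold M \<longleftrightarrow>
     (\<forall>p\<in>M. \<exists>U W (\<psi>::'a \<Rightarrow> 'a) \<psi>i S.
        open U \<and> p \<in> U \<and> open W \<and> subspace S \<and>
        C3_on U \<psi> \<and> C3_on W \<psi>i \<and> \<psi> ` U = W \<and>
        (\<forall>x\<in>U. \<psi>i (\<psi> x) = x) \<and> (\<forall>y\<in>W. \<psi> (\<psi>i y) = y) \<and>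
        \<psi> ` (M \<inter> U) = W \<inter> S)"

definition tangent_space :: "'a::euclidean_space set \<Rightarrow> 'a \<Rightarrow> 'a set" where
  "tangent_space M x = {v. \<exists>(\<gamma>::real \<Rightarrow> 'a) e. e > 0 \<and> \<gamma> 0 = x \<and>
      (\<forall>t\<in>{-e<..<e}. \<gamma> t \<in> M) \<and> (\<gamma> has_vector_derivative v) (at 0)}"

definition riem_dist :: "'a::euclidean_space set \<Rightarrow> 'a \<Rightarrow> 'a \<Rightarrow> real" where
  "riem_dist M x y = Inf {L. \<exists>\<gamma>::real \<Rightarrow> 'a.
      \<gamma> piecewise_C1_differentiable_on {0..1} \<and> \<gamma> 0 = x \<and> \<gamma> 1 = y \<and>
      \<gamma> ` {0..1} \<subseteq> M \<and>
      (\<lambda>t. norm (vector_derivative \<gamma> (at t))) integrable_on {0..1} \<and>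
      L = integral {0..1} (\<lambda>t. norm (vector_derivative \<gamma> (at t)))}"

definition mfld_C1 :: "'a::euclidean_space set \<Rightarrow> 'a set \<Rightarrow> ('a \<Rightarrow> 'b::euclidean_space) \<Rightarrow> bool" where
  "mfld_C1 M V F \<longleftrightarrow> (\<forall>x\<in>V. \<exists>U G. open U \<and> x \<in> U \<and> C1_on U G \<and> (\<forall>y\<in>V \<inter> U. G y = F y))"

text \<open>Range of the differential dF(x) : T_M(x) \<rightarrow> R^m, computed via any local C1 extension G
  of F (the value G'(x) v for tangent v does not depend on the extension).\<close>

definition mfld_diff_range ::
  "'a::euclidean_space set \<Rightarrow> 'a set \<Rightarrow> ('a \<Rightarrow> 'b::euclidean_space) \<Rightarrow> 'a \<Rightarrow> 'b set" where
  "mfld_diff_range M V F x = {w. \<exists>v\<in>tangent_space M x. \<exists>U G G'.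
      open U \<and> x \<in> U \<and> C1_on U G \<and> (\<forall>y\<in>V \<inter> U. G y = F y) \<and>
      (G has_derivative G') (at x) \<and> w = G' v}"

definition normal_cone :: "'b::euclidean_space set \<Rightarrow> 'b \<Rightarrow> 'b set" where
  "normal_cone D z = {y. \<forall>d\<in>D. inner y (d - z) \<le> 0}"

definition amenable_via ::
  "'a::euclidean_space set \<Rightarrow> 'a set \<Rightarrow> 'a \<Rightarrow> 'a set \<Rightarrow> ('a \<Rightarrow> 'b::euclidean_space) \<Rightarrow> 'b set \<Rightarrow> bool" where
  "amenable_via M C xbar V F D \<longleftrightarrow>
     openin (top_of_set M) V \<and> xbar \<in> V \<and> mfld_C1 M V F \<and> closed D \<and> convex D \<and>
     C \<inter> V = {x\<in>V. F x \<in> D} \<and>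
     (\<forall>y\<in>normal_cone D (F xbar). (\<forall>w\<in>mfld_diff_range M V F xbar. inner y w = 0) \<longrightarrow> y = 0)"

definition averaging_map :: "'a::euclidean_space set \<Rightarrow> 'a \<Rightarrow> 'a \<Rightarrow> (real \<Rightarrow> 'a) \<Rightarrow> bool" where
  "averaging_map M x x' g \<longleftrightarrow>
     (\<forall>t\<in>{0..1}. g t \<in> M) \<and> g 0 = x \<and> g 1 = x' \<and>
     (\<forall>t1\<in>{0..1}. \<forall>t2\<in>{0..1}. riem_dist M (g t1) (g t2) = \<bar>t1 - t2\<bar> * riem_dist M x x')"

definition smooth_curve_segment :: "'a::euclidean_space set \<Rightarrow> (real \<Rightarrow> 'a) \<Rightarrow> bool" where
  "smooth_curve_segment C \<gamma> \<longleftrightarrow>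
     (\<forall>t\<in>{0..1}. \<gamma> t \<in> C) \<and>
     (\<exists>U \<Gamma>. open U \<and> {0..1} \<subseteq> U \<and> C1_on U \<Gamma> \<and> (\<forall>t\<in>{0..1}. \<Gamma> t = \<gamma> t))"

definition smoothly_approx_convex :: "'a::euclidean_space set \<Rightarrow> 'a set \<Rightarrow> 'a \<Rightarrow> bool" where
  "smoothly_approx_convex M C xbar \<longleftrightarrow>
     (\<forall>\<epsilon>>0. \<exists>W. open W \<and> xbar \<in> W \<and>
        (\<forall>x\<in>C \<inter> W. \<forall>x'\<in>C \<inter> W. x \<noteq> x' \<longrightarrow>
           (\<exists>\<gamma>. smooth_curve_segment C \<gamma> \<and> \<gamma> 0 = x \<and> \<gamma> 1 = x' \<and>
              (\<forall>g. averaging_map M x x' g \<longrightarrow>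
                 (\<forall>t\<in>{0..1}. \<exists>v w. (\<gamma> has_vector_derivative v) (at t within {0..1}) \<and>
                    (g has_vector_derivative w) (at t within {0..1}) \<and>
                    norm (v - w) \<le> \<epsilon> * riem_dist M x x')))))"

end

theory Submission
  imports Defs
begin

text \<open>
  The curve \<open>\<gamma>\<close> and every averaging map \<open>g\<close> are compared with the constant velocity \<open>x' - x\<close>. In a
  chart of class C3, a linear projection onto the model subspace yields a local retraction \<open>P\<close> onto \<open>M\<close>
  with Lipschitz derivative, so that all estimates take place in the ambient space.

  Averaging maps: the image under \<open>P\<close> of the segment from \<open>x\<close> to \<open>y\<close> shows that the intrinsic distance
  exceeds the chord \<open>\<bar>y - x\<bar>\<close> only by \<open>O(\<bar>y - x\<bar>\<^sup>3)\<close>. By the parallelogram law, an averaging map of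
  length \<open>L\<close> then has second differences \<open>O(L\<^sup>2 h\<^sup>2)\<close>; hence it is differentiable and its velocity
  deviates from \<open>x' - x\<close> by \<open>O(L\<^sup>2)\<close>. No geodesic equation is needed.

  Curves in \<open>C\<close>: with \<open>H\<close> a local extension of \<open>F\<close> composed with \<open>P\<close>, and \<open>A\<close> its derivative at \<open>xbar\<close>,
  the qualification condition provides \<open>w0\<close> such that \<open>H xbar + A w0\<close> is in the relative interior of \<open>D\<close>,
  and makes the range of \<open>A\<close> and the direction space of \<open>D\<close> span everything. One moves along the
  segment from \<open>x\<close> to \<open>x'\<close>, pushed by a multiple \<open>\<kappa> \<bar>x' - x\<bar> t (1 - t)\<close> of \<open>w0\<close>, and corrects by the inverse
  function theorem; the correction is \<open>o(\<bar>x' - x\<bar>) t (1 - t)\<close>, hence absorbed by the push.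
\<close>

section \<open>Velocity of almost straight curves\<close>

text \<open>Stewart's identity expresses the squared distance of \<open>b\<close> from the point
  dividing the chord in ratio \<open>\<theta>\<close> through the three squared side lengths. The
  terms of order \<open>l^2\<close> cancel because \<open>(1 - \<theta>) * \<theta>^2 + \<theta> *
  (1 - \<theta>)^2 = \<theta> * (1 - \<theta>)\<close>, so only the defect of the long side
  survives.\<close>

lemma three_point_defect:
  fixes a b c :: "'a::real_inner"
  assumes \<theta>: "0 \<le> \<theta>" "\<theta> \<le> 1"
    and ab: "norm (b - a) \<le> \<theta> * l" and bc: "norm (c - b) \<le> (1 - \<theta>) * l"
    and ac: "l\<^sup>2 - \<kappa> * l ^ 4 \<le> (norm (c - a))\<^sup>2"
  shows "(norm ((b - a) - \<theta> *\<^sub>R (c - a)))\<^sup>2 \<le> \<theta> * (1 - \<theta>) * (\<kappa> * l ^ 4)"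
proof -
  define X Y where "X = c - a" and "Y = b - a"
  have XY: "c - b = X - Y" by (simp add: X_def Y_def)
  have 1: "(norm Y)\<^sup>2 \<le> (\<theta> * l)\<^sup>2"
    using ab unfolding Y_def by (intro power_mono) auto
  have 2: "(norm (X - Y))\<^sup>2 \<le> ((1 - \<theta>) * l)\<^sup>2"
    using bc unfolding XY by (intro power_mono) auto
  have "(norm (Y - \<theta> *\<^sub>R X))\<^sup>2
      = (1 - \<theta>) * (norm Y)\<^sup>2 + \<theta> * (norm (X - Y))\<^sup>2 - \<theta> * (1 - \<theta>) * (norm X)\<^sup>2"
    unfolding power2_norm_eq_inner
    by (simp add: inner_diff_left inner_diff_right inner_commute algebra_simps)
  also have "\<dots> \<le> (1 - \<theta>) * (\<theta> * l)\<^sup>2 + \<theta> * ((1 - \<theta>) * l)\<^sup>2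
      - \<theta> * (1 - \<theta>) * (l\<^sup>2 - \<kappa> * l ^ 4)"
    using \<theta> 1 2 ac unfolding X_def
    by (intro diff_mono add_mono mult_left_mono) auto
  also have "\<dots> = \<theta> * (1 - \<theta>) * (\<kappa> * l ^ 4)"
    by (simp add: power2_eq_square algebra_simps)
  finally show ?thesis unfolding X_def Y_def .
qed

text \<open>No differentiability is assumed; the two chord bounds alone will force a derivative.
  Averaging maps satisfy them with \<open>A = K * L\<^sup>2\<close>. Squares make the lower bound
  fit Stewart's identity.\<close>

locale almost_straight_curve =
  fixes g :: "real \<Rightarrow> 'a::euclidean_space" and L A :: real
  assumes L: "0 \<le> L" and A: "0 \<le> A"
    and upper: "\<And>s t. s \<in> {0..1} \<Longrightarrow> t \<in> {0..1} \<Longrightarrow> norm (g t - g s) \<le> L * \<bar>t - s\<bar>"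
    and lower: "\<And>s t. s \<in> {0..1} \<Longrightarrow> t \<in> {0..1} \<Longrightarrow>
      (L * \<bar>t - s\<bar>)\<^sup>2 - A\<^sup>2 * (t - s) ^ 4 \<le> (norm (g t - g s))\<^sup>2"
begin

definition slope :: "real \<Rightarrow> real \<Rightarrow> 'a" where
  "slope s h = (g (s + h) - g s) /\<^sub>R h"

text \<open>For \<open>\<theta> \<ge> 1/2\<close> one has
  \<open>1 - \<theta> \<le> \<theta>\<close>, so the square root of
  \<open>\<theta> * (1 - \<theta>)\<close> is at most \<open>\<theta>\<close>. The bound is then
  proportional to \<open>\<theta>\<close> and survives division by \<open>\<theta> * h\<close>. The
  step \<open>h\<close> may have either sign.\<close>

lemma chord_defect:
  assumes s: "s \<in> {0..1}" "s + h \<in> {0..1}" and \<theta>: "1/2 \<le> \<theta>" "\<theta> \<le> 1"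
  shows "norm ((g (s + \<theta> * h) - g s) - \<theta> *\<^sub>R (g (s + h) - g s)) \<le> \<theta> * (A * h\<^sup>2)"
proof -
  have m: "s + \<theta> * h \<in> {0..1}"
  proof -
    have "s + \<theta> * h = (1 - \<theta>) * s + \<theta> * (s + h)" by (simp add: algebra_simps)
    moreover have "\<dots> \<in> {0..1}" using s \<theta> by (auto intro!: convex_bound_le add_nonneg_nonneg)
    ultimately show ?thesis by simp
  qed
  show ?thesis
  \<comment> \<open>The defect enters \<open>three_point_defect\<close> with the factor
    \<open>A\<^sup>2 / L ^ 4\<close>, hence the separate case; for \<open>L = 0\<close> the curve is
    constant.\<close>
  proof (cases "L = 0")
    case True
    then have "g (s + \<theta> * h) = g s" "g (s + h) = g s"
      using upper[OF s] upper[OF s(1) m] by auto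
    then show ?thesis using A \<theta> by simp
  next
    case False
    then have "L > 0" using L by simp
    define l where "l = L * \<bar>h\<bar>"
    have l4: "(A\<^sup>2 / L ^ 4) * l ^ 4 = A\<^sup>2 * h ^ 4"
      using \<open>L > 0\<close> by (simp add: l_def power_mult_distrib)
    have "(norm ((g (s + \<theta> * h) - g s) - \<theta> *\<^sub>R (g (s + h) - g s)))\<^sup>2
        \<le> \<theta> * (1 - \<theta>) * ((A\<^sup>2 / L ^ 4) * l ^ 4)"
    proof (rule three_point_defect)
      show "norm (g (s + \<theta> * h) - g s) \<le> \<theta> * l"
        using upper[OF s(1) m] \<theta> by (simp add: l_def abs_mult mult_ac)
      have "s + h - (s + \<theta> * h) = (1 - \<theta>) * h" by (simp add: algebra_simps)
      then have "\<bar>s + h - (s + \<theta> * h)\<bar> = (1 - \<theta>) * \<bar>h\<bar>" using \<theta> by (simp add: abs_mult)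
      then show "norm (g (s + h) - g (s + \<theta> * h)) \<le> (1 - \<theta>) * l"
        using upper[OF m s(2)] by (simp add: l_def mult_ac)
      show "l\<^sup>2 - A\<^sup>2 / L ^ 4 * l ^ 4 \<le> (norm (g (s + h) - g s))\<^sup>2"
        using lower[OF s] unfolding l4 by (simp add: l_def)
    qed (use \<theta> in auto)
    also have "\<dots> = (\<theta> * (1 - \<theta>)) * (A\<^sup>2 * h ^ 4)" by (simp only: l4)
    also have "\<dots> \<le> (\<theta> * \<theta>) * (A\<^sup>2 * h ^ 4)"
      using \<theta> by (intro mult_right_mono mult_left_mono) auto
    also have "\<dots> = (\<theta> * (A * h\<^sup>2))\<^sup>2" by (simp add: power2_eq_square power4_eq_xxxx)
    finally show ?thesis
      by (rule power2_le_imp_le) (use A \<theta> in auto)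
  qed
qed

lemma slope_half:
  assumes s: "s \<in> {0..1}" "s + h \<in> {0..1}" "h \<noteq> 0" and \<theta>: "1/2 \<le> \<theta>" "\<theta> \<le> 1"
  shows "norm (slope s (\<theta> * h) - slope s h) \<le> A * \<bar>h\<bar>"
proof -
  have "slope s (\<theta> * h) - slope s h =
      ((g (s + \<theta> * h) - g s) - \<theta> *\<^sub>R (g (s + h) - g s)) /\<^sub>R (\<theta> * h)"
  proof -
    have "inverse (\<theta> * h) * \<theta> = inverse h" using \<theta> by simp
    then show ?thesis by (simp only: slope_def scaleR_diff_right[of _ _ "\<theta> *\<^sub>R _"] scaleR_scaleR)
  qed
  then have "norm (slope s (\<theta> * h) - slope s h)
      = norm ((g (s + \<theta> * h) - g s) - \<theta> *\<^sub>R (g (s + h) - g s)) / (\<theta> * \<bar>h\<bar>)"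
    using \<theta> by (simp add: divide_simps abs_mult)
  also have "\<dots> \<le> \<theta> * (A * h\<^sup>2) / (\<theta> * \<bar>h\<bar>)"
    using chord_defect[OF s(1,2) \<theta>] \<theta> by (intro divide_right_mono) auto
  also have "\<dots> = A * \<bar>h\<bar>"
    using \<theta> s by (simp add: power2_eq_square divide_simps)
  finally show ?thesis .
qed

text \<open>Each halving of the step changes the slope by at most \<open>A\<close> times the current
  step. The geometric series \<open>1 + 1/2 + 1/4 + ...\<close> sums to the factor 2, and at most
  one last step with ratio in \<open>[1/2, 1]\<close> is needed. The induction counts the
  halvings.\<close>

lemma slope_same_side:
  assumes "s \<in> {0..1}" "s + h \<in> {0..1}" "h \<noteq> 0" and \<theta>: "0 < \<theta>" "\<theta> \<le> 1"
  shows "norm (slope s (\<theta> * h) - slope s h) \<le> 2 * A * \<bar>h\<bar>"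
proof -
  have *: "norm (slope s (\<theta> * h) - slope s h) \<le> 2 * A * \<bar>h\<bar>"
    if "s + h \<in> {0..1}" "h \<noteq> 0" "(1/2) ^ n \<le> \<theta>" "\<theta> \<le> 1" for n h \<theta>
    using that
  proof (induction n arbitrary: h \<theta>)
    case 0
    then show ?case using A by simp
  next
    case (Suc n)
    show ?case
    proof (cases "1/2 \<le> \<theta>")
      case True
      have "norm (slope s (\<theta> * h) - slope s h) \<le> A * \<bar>h\<bar>"
        by (rule slope_half) (use True Suc.prems assms in auto)
      also have "\<dots> \<le> 2 * A * \<bar>h\<bar>" using A by (simp add: mult_right_mono)
      finally show ?thesis .
    next
      case False
      have h2: "s + h/2 \<in> {0..1}" using Suc.prems assms(1) by auto
      have "norm (slope s ((2 * \<theta>) * (h/2)) - slope s (h/2)) \<le> 2 * A * \<bar>h/2\<bar>"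
        using Suc.prems False h2 by (intro Suc.IH) auto
      moreover have "norm (slope s (1/2 * h) - slope s h) \<le> A * \<bar>h\<bar>"
        by (rule slope_half) (use Suc.prems assms in auto)
      ultimately show ?thesis
        using norm_triangle_ineq[of "slope s (\<theta> * h) - slope s (h/2)" "slope s (h/2) - slope s h"]
        by simp
    qed
  qed
  obtain n where "(1/2) ^ n < \<theta>"
    using real_arch_pow_inv[of \<theta> "1/2"] \<theta> by auto
  then show ?thesis using *[of h n \<theta>] assms by simp
qed

text \<open>The difference of the two slopes is the symmetric second difference at \<open>s\<close>
  divided by \<open>k\<close>. The midpoint case of \<open>chord_defect\<close>, with base point
  \<open>s - k\<close> and step \<open>2 * k\<close>, bounds this second difference.\<close>

lemma slope_opposite:
  assumes s: "s \<in> {0..1}" "s + k \<in> {0..1}" "s - k \<in> {0..1}" "k > 0"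
  shows "norm (slope s k - slope s (- k)) \<le> 4 * A * k"
proof -
  have "norm ((g (s - k + 1/2 * (2 * k)) - g (s - k)) - (1/2) *\<^sub>R (g (s - k + 2 * k) - g (s - k)))
      \<le> 1/2 * (A * (2 * k)\<^sup>2)"
    by (rule chord_defect) (use s in auto)
  moreover have "(g (s - k + 1/2 * (2 * k)) - g (s - k)) - (1/2) *\<^sub>R (g (s - k + 2 * k) - g (s - k))
     = (- 1/2) *\<^sub>R ((g (s + k) - g s) + (g (s - k) - g s))"
  proof -
    have "(b - a) - (1/2) *\<^sub>R (c - a) = (- 1/2) *\<^sub>R ((c - b) + (a - b))" for a b c :: 'a
      by (rule euclidean_eqI) (simp add: inner_add_left inner_diff_left, argo)
    moreover have "s - k + 1/2 * (2 * k) = s" "s - k + 2 * k = s + k" by simp_all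
    ultimately show ?thesis by metis
  qed
  ultimately have "norm ((g (s + k) - g s) + (g (s - k) - g s)) \<le> 4 * A * k\<^sup>2"
    by (simp add: power_mult_distrib)
  moreover have "slope s k - slope s (- k) = ((g (s + k) - g s) + (g (s - k) - g s)) /\<^sub>R k"
    by (simp add: slope_def scaleR_add_right)
  ultimately have "norm (slope s k - slope s (- k)) \<le> (4 * A * k\<^sup>2) / k"
    using s by (simp add: divide_right_mono divide_inverse_commute mult_left_mono)
  also have "\<dots> = 4 * A * k" using s by (simp add: power2_eq_square)
  finally show ?thesis .
qed

text \<open>Steps of equal sign are compared directly. For opposite signs both are first shortened
  to a common length, and the symmetric pair is compared there: 2 + 4 + 2 gives the factor
  8.\<close>

lemma slope_Cauchy:
  assumes s: "s \<in> {0..1}" "s + h \<in> {0..1}" "h \<noteq> 0" "s + k \<in> {0..1}" "k \<noteq> 0"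
  shows "norm (slope s h - slope s k) \<le> 8 * A * max (abs h) (abs k)"
proof -
  have same: "norm (slope s h - slope s k) \<le> 2 * A * \<bar>k\<bar>"
    if "s + k \<in> {0..1}" "h * k > 0" "\<bar>h\<bar> \<le> \<bar>k\<bar>" "k \<noteq> 0" for h k
  proof -
    have "0 < h / k" "h / k \<le> 1" using that
      by (auto simp: zero_less_mult_iff divide_simps split: if_splits)
    then show ?thesis using slope_same_side[of s k "h / k"] s(1) that by simp
  qed
  show ?thesis
  proof (cases "h * k > 0")
    case True
    then have "norm (slope s h - slope s k) \<le> 2 * A * max (abs h) (abs k)"
      using same[of k h] same[of h k] s
      by (cases "\<bar>h\<bar> \<le> \<bar>k\<bar>") (auto simp: norm_minus_commute mult.commute max_def)
    also have "\<dots> \<le> 8 * A * max (abs h) (abs k)" using A by (intro mult_right_mono) auto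
    finally show ?thesis .
  next
    case False
    have opp: "norm (slope s h - slope s k) \<le> 8 * A * max (abs h) (abs k)"
      if hk: "h > 0" "k < 0" "s + h \<in> {0..1}" "s + k \<in> {0..1}" for h k
    proof -
      \<comment> \<open>The smaller of the two lengths keeps both \<open>s + m\<close> and
        \<open>s - m\<close> inside the parameter interval.\<close>
      define m where "m = min h (- k)"
      have m: "m > 0" "m \<le> h" "m \<le> - k" using hk by (auto simp: m_def)
      have in01: "s + m \<in> {0..1}" "s - m \<in> {0..1}" using m hk s(1) by auto
      have 1: "norm (slope s m - slope s h) \<le> 2 * A * \<bar>h\<bar>"
        using same[of h m] hk m by simp
      have 2: "norm (slope s (- m) - slope s k) \<le> 2 * A * \<bar>k\<bar>"
        using same[of k "- m"] hk m by (simp add: mult_pos_neg)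
      have 3: "norm (slope s m - slope s (- m)) \<le> 4 * A * m"
        using slope_opposite[of s m] in01 m s(1) by simp
      have "norm (slope s h - slope s k) = norm ((slope s m - slope s (- m)) - (slope s m - slope s h)
          + (slope s (- m) - slope s k))" by simp
      also have "\<dots> \<le> norm (slope s m - slope s (- m)) + norm (slope s m - slope s h)
          + norm (slope s (- m) - slope s k)"
        by (meson norm_triangle_ineq norm_triangle_ineq4 add_mono order_trans order_refl)
      also have "\<dots> \<le> 4 * A * m + 2 * A * \<bar>h\<bar> + 2 * A * \<bar>k\<bar>" using 1 2 3 by linarith
      also have "\<dots> \<le> 4 * A * max (abs h) (abs k) + 2 * A * max (abs h) (abs k) + 2 * A * max (abs h) (abs k)"
        using A m hk by (intro add_mono mult_left_mono) auto
      finally show ?thesis by simp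
    qed
    show ?thesis
    proof (cases "h > 0")
      case True
      then have "k < 0" using False s(5) by (auto simp: zero_less_mult_iff)
      then show ?thesis using opp[of h k] True s by blast
    next
      case F: False
      then have "h < 0" "k > 0" using False s by (auto simp: zero_less_mult_iff)
      then show ?thesis using opp[of k h] s by (simp add: norm_minus_commute max.commute)
    qed
  qed
qed

text \<open>The vector \<open>d\<close> is the limit of slopes along one sequence of admissible
  steps. Letting one of the two steps in \<open>slope_Cauchy\<close> tend to 0 yields the quadratic
  error for every \<open>t\<close>, on both sides of \<open>s\<close>.\<close>

lemma has_tangent:
  assumes s: "s \<in> {0..1}"
  obtains d where "\<And>t. t \<in> {0..1} \<Longrightarrow> norm (g t - g s - (t - s) *\<^sub>R d) \<le> 8 * A * (t - s)\<^sup>2"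
proof -
  \<comment> \<open>Steps of length at most 1/2 point right from the left half and left from the
    right half, so they never leave the interval.\<close>
  define \<sigma> where "\<sigma> = (if s \<le> 1/2 then 1/2 else - 1/2 :: real)"
  define h where "h n = \<sigma> * inverse (real (Suc n))" for n
  have inv: "0 < inverse (real (Suc n))" "inverse (real (Suc n)) \<le> 1" for n
    by (auto simp: field_simps)
  have h0: "h n \<noteq> 0" for n using inv[of n] by (auto simp: h_def \<sigma>_def)
  have h: "s + h n \<in> {0..1}" for n
  proof -
    have "s + \<sigma> * k \<in> {0..1}" if "0 < k" "k \<le> 1" for k
      using s that by (cases "s \<le> 1/2") (auto simp: \<sigma>_def)
    then show ?thesis using inv[of n] by (simp only: h_def)
  qed
  have hlim: "h \<longlonglongrightarrow> 0"
    unfolding h_def using tendsto_mult_right_zero[OF LIMSEQ_inverse_real_of_nat] by simp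
  then have Alim: "(\<lambda>n. 8 * A * \<bar>h n\<bar>) \<longlonglongrightarrow> 0"
    using tendsto_mult_right_zero tendsto_rabs_zero by blast
  have "Cauchy (\<lambda>n. slope s (h n))"
  proof (rule CauchyI)
    fix e :: real assume "e > 0"
    then obtain N where N: "\<And>n. n \<ge> N \<Longrightarrow> 8 * A * \<bar>h n\<bar> < e"
      using order_tendstoD(2)[OF Alim, of e] by (auto simp: eventually_sequentially)
    have "norm (slope s (h m) - slope s (h n)) < e" if "m \<ge> N" "n \<ge> N" for m n
      using slope_Cauchy[OF s h h0 h h0, of m n] N that
      by (cases "\<bar>h m\<bar> \<le> \<bar>h n\<bar>") (fastforce simp: max_def)+
    then show "\<exists>N. \<forall>m\<ge>N. \<forall>n\<ge>N. norm (slope s (h m) - slope s (h n)) < e" by blast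
  qed
  then obtain d where d: "(\<lambda>n. slope s (h n)) \<longlonglongrightarrow> d"
    using Cauchy_convergent_iff convergent_def by blast
  show thesis
  proof
    fix t :: real assume t: "t \<in> {0..1}"
    show "norm (g t - g s - (t - s) *\<^sub>R d) \<le> 8 * A * (t - s)\<^sup>2"
    proof (cases "t = s")
      case False
      have "norm (slope s (t - s) - d) \<le> 8 * A * max (abs (t - s)) (abs 0)"
      proof (rule tendsto_le[OF sequentially_bot])
        show "(\<lambda>n. norm (slope s (t - s) - slope s (h n))) \<longlonglongrightarrow> norm (slope s (t - s) - d)"
          using d by (intro tendsto_intros)
        show "(\<lambda>n. 8 * A * max (abs (t - s)) (abs (h n))) \<longlonglongrightarrow> 8 * A * max (abs (t - s)) (abs 0)"
          using hlim by (intro tendsto_intros)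
        show "\<forall>\<^sub>F n in sequentially. norm (slope s (t - s) - slope s (h n)) \<le> 8 * A * max (abs (t - s)) (abs (h n))"
          using slope_Cauchy[OF s _ _ h h0] t False by simp
      qed
      moreover have "g t - g s - (t - s) *\<^sub>R d = (t - s) *\<^sub>R (slope s (t - s) - d)"
        using False by (simp add: slope_def scaleR_diff_right)
      moreover have "\<bar>t - s\<bar> * (8 * A * \<bar>t - s\<bar>) = 8 * A * (t - s)\<^sup>2"
        by (simp add: power2_eq_square)
      ultimately show ?thesis
        using mult_left_mono[of "norm (slope s (t - s) - d)" "8 * A * \<bar>t - s\<bar>" "\<bar>t - s\<bar>"]
        by (metis abs_ge_zero abs_zero max.absorb1 norm_scaleR real_norm_def)
    qed simp
  qed
qed

text \<open>Subtracting the tangent estimates at the two end points isolates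
  \<open>d - (g 1 - g 0)\<close>; the errors add up to at most \<open>8 * A\<close> because
  \<open>s^2 + (1 - s)^2 \<le> 1\<close>.\<close>

lemma derivative_near_chord:
  assumes s: "s \<in> {0..1}"
  shows "\<exists>d. (g has_vector_derivative d) (at s within {0..1}) \<and> norm (d - (g 1 - g 0)) \<le> 8 * A"
proof -
  obtain d where d: "\<And>t. t \<in> {0..1} \<Longrightarrow> norm (g t - g s - (t - s) *\<^sub>R d) \<le> 8 * A * (t - s)\<^sup>2"
    using has_tangent[OF s] by blast
  have "(g has_vector_derivative d) (at s within {0..1})"
    unfolding has_vector_derivative_def has_derivative_within_alt
  proof (intro conjI allI impI bounded_linear_scaleR_left)
    fix e :: real assume e: "e > 0"
    show "\<exists>del>0. \<forall>t\<in>{0..1}. norm (t - s) < del \<longrightarrow>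
        norm (g t - g s - (t - s) *\<^sub>R d) \<le> e * norm (t - s)"
    proof (intro exI[of _ "e / (8 * A + 1)"] conjI ballI impI)
      show "e / (8 * A + 1) > 0" using e A by simp
      fix t :: real assume t: "t \<in> {0..1}" "norm (t - s) < e / (8 * A + 1)"
      then have "\<bar>t - s\<bar> * (8 * A + 1) \<le> e" using A by (simp add: field_simps)
      then have "8 * A * \<bar>t - s\<bar> \<le> e" by (simp add: algebra_simps)
      then have "8 * A * \<bar>t - s\<bar> * \<bar>t - s\<bar> \<le> e * \<bar>t - s\<bar>" by (rule mult_right_mono) simp
      then show "norm (g t - g s - (t - s) *\<^sub>R d) \<le> e * norm (t - s)"
        using d[OF t(1)] by (simp add: power2_eq_square abs_mult_self_eq mult.assoc)
    qed
  qed
  moreover have "norm (d - (g 1 - g 0)) \<le> 8 * A"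
  proof -
    have "d - (g 1 - g 0) = (g 0 - g s - (0 - s) *\<^sub>R d) - (g 1 - g s - (1 - s) *\<^sub>R d)"
      by (simp add: algebra_simps)
    also have "norm \<dots> \<le> 8 * A * (0 - s)\<^sup>2 + 8 * A * (1 - s)\<^sup>2"
      using d[of 0] d[of 1] norm_triangle_ineq4 by (smt (verit) atLeastAtMost_iff)
    also have "\<dots> = 8 * A * (s\<^sup>2 + (1 - s)\<^sup>2)" by (simp add: algebra_simps)
    also have "\<dots> \<le> 8 * A * 1"
    proof (rule mult_left_mono)
      have "s * s \<le> s * 1" using s by (intro mult_left_mono) auto
      then show "s\<^sup>2 + (1 - s)\<^sup>2 \<le> 1" by (simp add: power2_eq_square algebra_simps)
    qed (use A in simp)
    finally show ?thesis by simp
  qed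
  ultimately show ?thesis by blast
qed

end

section \<open>Constraint qualification\<close>

lemma ex_linear_projection:
  fixes S :: "'a::real_vector set"
  assumes "subspace S"
  obtains \<pi> where "linear \<pi>" "range \<pi> \<subseteq> S" "\<And>x. x \<in> S \<Longrightarrow> \<pi> x = x"
proof -
  obtain \<pi> where "range \<pi> \<subseteq> S \<and> linear \<pi> \<and> (\<forall>x\<in>S. \<pi> (id x) = x)"
    using linear_exists_left_inverse_on[OF linear_id assms inj_on_id] by blast
  then show thesis by (intro that[of \<pi>]) auto
qed

text \<open>Two consequences of the qualification are combined. The affine space
  \<open>y0 + range A\<close> meets the relative interior of \<open>D\<close>, which gives
  \<open>w0\<close>; and \<open>range A\<close> together with the direction space of
  \<open>D\<close> spans everything, which gives \<open>w1\<close> and \<open>\<sigma>\<close> from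
  a linear right inverse. Since \<open>\<sigma>\<close> moves only inside the affine hull of
  \<open>D\<close>, small values of it keep a relative interior point in \<open>D\<close>.\<close>

lemma constraint_qualification_splitting:
  fixes A :: "'a::euclidean_space \<Rightarrow> 'b::euclidean_space"
  assumes A: "linear A" and D: "convex D" "y0 \<in> D"
    and cq: "\<And>y. y \<in> normal_cone D y0 \<Longrightarrow> (\<And>v. inner y (A v) = 0) \<Longrightarrow> y = 0"
  obtains w0 :: 'a and w1 :: "'b \<Rightarrow> 'a" and \<sigma> :: "'b \<Rightarrow> 'b" and \<rho> :: real
  where "linear w1" "linear \<sigma>" "\<rho> > 0" "\<And>u. A (w1 u) - \<sigma> u = u"
    "\<And>u. norm (\<sigma> u) \<le> \<rho> \<Longrightarrow> y0 + A w0 + \<sigma> u \<in> D"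
proof -
  have "\<exists>w0. y0 + A w0 \<in> rel_interior D"
  proof (rule ccontr)
    assume neg: "\<not> ?thesis"
    let ?T = "(\<lambda>z. y0 + z) ` range A"
    have T: "convex ?T"
      using A by (intro convex_translation subspace_imp_convex linear_subspace_image) auto
    have "rel_interior D \<inter> ?T = {}" using neg by auto
    moreover have "rel_interior D \<noteq> {}" using rel_interior_eq_empty[OF D(1)] D(2) by auto
    ultimately have "\<exists>y b. y \<noteq> 0 \<and> (\<forall>d\<in>rel_interior D. inner y d \<le> b) \<and> (\<forall>z\<in>?T. b \<le> inner y z)"
      using T convex_rel_interior[OF D(1)] by (intro separating_hyperplane_sets) auto
    then obtain y b where y: "y \<noteq> 0" "\<And>d. d \<in> rel_interior D \<Longrightarrow> inner y d \<le> b"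
      "\<And>z. z \<in> ?T \<Longrightarrow> b \<le> inner y z"
      by blast
    have orth: "inner y (A v) = 0" for v
    proof (rule ccontr)
      assume nz: "inner y (A v) \<noteq> 0"
      \<comment> \<open>Moving along \<open>A v\<close> by this multiple would bring the functional
        down to \<open>b - 1\<close>, below its lower bound on the affine space.\<close>
      define c where "c = (b - 1 - inner y y0) / inner y (A v)"
      have "b \<le> inner y (y0 + A (c *\<^sub>R v))" using y(3) by blast
      also have "\<dots> = b - 1" using nz by (simp add: linear_scale[OF A] inner_add_right c_def)
      finally show False by simp
    qed
    have "b \<le> inner y (y0 + A 0)" using y(3) by blast
    then have b: "b \<le> inner y y0" by (simp add: linear_0[OF A])
    \<comment> \<open>A convex set lies in the closure of its relative interior, so the separation
      extends to all of \<open>D\<close> and \<open>y\<close> is a normal vector at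
      \<open>y0\<close>.\<close>
    have "closure (rel_interior D) \<subseteq> {d. inner y d \<le> b}"
      using y(2) by (intro closure_minimal closed_halfspace_le) auto
    then have "D \<subseteq> {d. inner y d \<le> b}"
      using convex_closure_rel_interior[OF D(1)] closure_subset[of D] by auto
    then have "y \<in> normal_cone D y0"
      using b by (force simp: normal_cone_def inner_diff_right)
    then show False using cq orth y(1) by blast
  qed
  then obtain w0 where w0: "y0 + A w0 \<in> rel_interior D" by blast
  define d0 where "d0 = y0 + A w0"
  obtain \<rho> where \<rho>: "\<rho> > 0" "cball d0 \<rho> \<inter> affine hull D \<subseteq> D" and d0: "d0 \<in> D"
    using w0 mem_rel_interior_cball unfolding d0_def by blast
  define T where "T = (\<lambda>x. x - d0) ` (affine hull D)"
  have "subspace T" unfolding T_def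
    using d0 hull_inc by (intro affine_diffs_subspace_subtract affine_affine_hull) fast
  then obtain \<pi> where \<pi>: "linear \<pi>" "range \<pi> \<subseteq> T" "\<And>x. x \<in> T \<Longrightarrow> \<pi> x = x"
    using ex_linear_projection by blast
  define B where "B = (\<lambda>(w, s). A w - \<pi> s)"
  have B: "linear B" unfolding B_def split_def
    using linear_compose[OF linear_fst A] linear_compose[OF linear_snd \<pi>(1)]
    by (intro linear_compose_sub) (auto simp: o_def)
  \<comment> \<open>A nonzero \<open>y\<close> orthogonal to the range of \<open>B\<close> is
    orthogonal to \<open>T\<close>, hence constant on \<open>D\<close>; so it lies in the normal
    cone and is orthogonal to \<open>range A\<close>, against the qualification.\<close>
  have "surj B"
  proof (rule ccontr)
    assume "\<not> surj B"
    then have "span (range B) \<noteq> UNIV"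
      by (metis B span_eq_iff subspace_UNIV linear_subspace_image)
    then obtain y where y: "y \<noteq> 0" "span (range B) \<subseteq> {x. y \<bullet> x = 0}"
      using span_not_univ_subset_hyperplane by blast
    have yB: "inner y (B z) = 0" for z
      using y(2) span_base[OF rangeI, of B z] by blast
    have "inner y (A v) = 0" for v
      using yB[of "(v, 0)"] by (simp add: B_def linear_0[OF \<pi>(1)])
    moreover have "inner y s = 0" if "s \<in> T" for s
      using yB[of "(0, s)"] that by (simp add: B_def linear_0[OF A] \<pi>(3))
    then have "inner y (d - d0) = 0" if "d \<in> D" for d
      using that hull_inc[of d D affine] by (force simp: T_def)
    then have "inner y (d - y0) = 0" if "d \<in> D" for d
      using that D(2) by (simp add: inner_diff_right)
    then have "y \<in> normal_cone D y0" by (simp add: normal_cone_def)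
    ultimately show False using cq y(1) by blast
  qed
  then obtain R where R: "linear R" "B \<circ> R = id"
    using linear_surjective_right_inverse[OF B] by blast
  show thesis
  proof
    show "linear (\<lambda>u. fst (R u))" using linear_compose[OF R(1) linear_fst] by (simp add: o_def)
    show "linear (\<lambda>u. \<pi> (snd (R u)))"
      using linear_compose[OF linear_compose[OF R(1) linear_snd] \<pi>(1)] by (simp add: o_def)
    show "A (fst (R u)) - \<pi> (snd (R u)) = u" for u
      using fun_cong[OF R(2), of u] by (simp add: B_def split_def)
    show "y0 + A w0 + \<pi> (snd (R u)) \<in> D" if "norm (\<pi> (snd (R u))) \<le> \<rho>" for u
    proof -
      have "\<pi> (snd (R u)) \<in> T" using \<pi>(2) by blast
      then have "d0 + \<pi> (snd (R u)) \<in> affine hull D" by (auto simp: T_def)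
      moreover have "d0 + \<pi> (snd (R u)) \<in> cball d0 \<rho>" using that by (simp add: dist_norm)
      ultimately show ?thesis using \<rho>(2) by (auto simp: d0_def)
    qed
  qed (rule \<rho>(1))
qed

section \<open>Intrinsic distance on a submanifold\<close>

text \<open>The set under the infimum of \<open>riem_dist\<close> gets a name because
  \<open>Inf {}\<close> is an unspecified real: the existence of a path has to be tracked as a
  separate condition.\<close>

definition connecting_lengths :: "'a::euclidean_space set \<Rightarrow> 'a \<Rightarrow> 'a \<Rightarrow> real set" where
  "connecting_lengths M x y = {L. \<exists>\<gamma>::real \<Rightarrow> 'a.
      \<gamma> piecewise_C1_differentiable_on {0..1} \<and> \<gamma> 0 = x \<and> \<gamma> 1 = y \<and>
      \<gamma> ` {0..1} \<subseteq> M \<and>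
      (\<lambda>t. norm (vector_derivative \<gamma> (at t))) integrable_on {0..1} \<and>
      L = integral {0..1} (\<lambda>t. norm (vector_derivative \<gamma> (at t)))}"

lemma riem_dist_eq: "riem_dist M x y = Inf (connecting_lengths M x y)"
  by (simp add: riem_dist_def connecting_lengths_def)

lemma connecting_lengths_ge_norm:
  assumes "L \<in> connecting_lengths M x y"
  shows "norm (y - x) \<le> L"
proof -
  obtain \<gamma> :: "real \<Rightarrow> 'a" where \<gamma>: "\<gamma> piecewise_C1_differentiable_on {0..1}" "\<gamma> 0 = x" "\<gamma> 1 = y"
    "(\<lambda>t. norm (vector_derivative \<gamma> (at t))) integrable_on {0..1}"
    "L = integral {0..1} (\<lambda>t. norm (vector_derivative \<gamma> (at t)))"
    using assms by (auto simp: connecting_lengths_def)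
  obtain S where S: "finite S" "continuous_on {0..1} \<gamma>" "\<gamma> C1_differentiable_on ({0..1} - S)"
    using \<gamma>(1) by (auto simp: piecewise_C1_differentiable_on_def)
  have "((\<lambda>t. vector_derivative \<gamma> (at t)) has_integral (\<gamma> 1 - \<gamma> 0)) {0..1}"
  proof (rule fundamental_theorem_of_calculus_interior_strong[OF S(1)])
    show "(\<gamma> has_vector_derivative vector_derivative \<gamma> (at t)) (at t)" if "t \<in> {0<..<1} - S" for t
    proof -
      have "\<gamma> differentiable at t" using S(3) that by (auto simp: C1_differentiable_on_eq)
      then show ?thesis by (simp add: vector_derivative_works)
    qed
  qed (use S in auto)
  then have "norm (y - x) = norm (integral {0..1} (\<lambda>t. vector_derivative \<gamma> (at t)))"
    and "(\<lambda>t. vector_derivative \<gamma> (at t)) integrable_on {0..1}"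
    using \<gamma> by (auto simp: integral_unique)
  then show ?thesis using integral_norm_bound_integral[OF _ \<gamma>(4)] \<gamma>(5) by auto
qed

lemma norm_le_riem_dist:
  assumes "connecting_lengths M x y \<noteq> {}"
  shows "norm (y - x) \<le> riem_dist M x y"
  unfolding riem_dist_eq using assms connecting_lengths_ge_norm by (intro cInf_greatest) auto

lemma riem_dist_le:
  assumes "L \<in> connecting_lengths M x y"
  shows "riem_dist M x y \<le> L"
  unfolding riem_dist_eq
  by (rule cInf_lower[OF assms]) (auto intro!: bdd_belowI dest: connecting_lengths_ge_norm)

section \<open>Local retraction onto a C3 submanifold\<close>

lemma C1_on_imp_continuous_on: "C1_on U f \<Longrightarrow> continuous_on U f"
  unfolding C1_on_def by (meson continuous_at_imp_continuous_on has_derivative_continuous)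

lemma C2_on_imp_C1_on: "C2_on U f \<Longrightarrow> C1_on U f"
  unfolding C2_on_def C1_on_def[of U f] using C1_on_imp_continuous_on by blast

text \<open>The mean value inequality on a ball where the derivative is within 1 of its value at the
  center. Applied to the derivatives of the charts, it gives Lipschitz derivatives together with a
  bound on their size.\<close>

lemma C1_on_locally_Lipschitz:
  fixes f :: "'a::real_normed_vector \<Rightarrow> 'b::real_normed_vector"
  assumes "C1_on U f" "open U" "x \<in> U"
  shows "\<exists>r>0. \<exists>K\<ge>0. ball x r \<subseteq> U \<and>
    (\<forall>y\<in>ball x r. \<forall>z\<in>ball x r. norm (f y - f z) \<le> K * norm (y - z)) \<and>
    (\<forall>y\<in>ball x r. norm (f y) \<le> norm (f x) + K)"
proof -
  obtain f' :: "'a \<Rightarrow> 'a \<Rightarrow>\<^sub>L 'b" where f': "\<And>x. x \<in> U \<Longrightarrow> (f has_derivative blinfun_apply (f' x)) (at x)"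
    "continuous_on U f'"
    using assms(1) unfolding C1_on_def by blast
  obtain r0 where r0: "r0 > 0" "ball x r0 \<subseteq> U" using assms(2,3) openE by blast
  have "continuous (at x) f'" using f'(2) assms(2,3) continuous_on_eq_continuous_at by blast
  then obtain r1 where r1: "r1 > 0" "\<And>y. dist y x < r1 \<Longrightarrow> dist (f' y) (f' x) < 1"
    unfolding continuous_at_eps_delta by (meson zero_less_one)
  \<comment> \<open>Radius at most 1 lets the Lipschitz constant \<open>K\<close> also bound the
    growth of \<open>f\<close> over the ball.\<close>
  define r where "r = min (min r0 r1) 1"
  define K where "K = norm (f' x) + 1"
  have r: "r > 0" "r \<le> 1" "ball x r \<subseteq> U" using r0 r1 unfolding r_def by force+
  have lip: "norm (f y - f z) \<le> K * norm (y - z)" if "y \<in> ball x r" "z \<in> ball x r" for y z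
  proof (rule differentiable_bound[OF convex_ball _ _ that])
    fix v assume v: "v \<in> ball x r"
    then show "(f has_derivative blinfun_apply (f' v)) (at v within ball x r)"
      using f'(1) r(3) has_derivative_at_withinI by blast
    have "norm (f' v - f' x) < 1"
      using r1(2)[of v] v by (simp add: dist_norm r_def norm_minus_commute)
    then have "norm (f' v) \<le> K"
      unfolding K_def using norm_triangle_sub[of "f' v" "f' x"] by linarith
    then show "onorm (blinfun_apply (f' v)) \<le> K" by (simp add: norm_blinfun.rep_eq)
  qed
  have K: "K \<ge> 0" by (simp add: K_def)
  have "norm (f y) \<le> norm (f x) + K" if y: "y \<in> ball x r" for y
  proof -
    have "norm (f y - f x) \<le> K * norm (y - x)" using lip[OF y] r(1) by simp
    also have "\<dots> \<le> K * 1" using y r(2) K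
      by (intro mult_left_mono) (auto simp: dist_norm norm_minus_commute)
    finally show ?thesis using norm_triangle_sub[of "f y" "f x"] by linarith
  qed
  then show ?thesis using r K lip by blast
qed

text \<open>Not the nearest point projection: any map into \<open>M\<close> that fixes the nearby
  points of \<open>M\<close> serves, as long as its derivative is Lipschitz.\<close>

locale C11_retraction =
  fixes M :: "'a::euclidean_space set" and p :: 'a and r K :: real
    and P :: "'a \<Rightarrow> 'a" and P' :: "'a \<Rightarrow> 'a \<Rightarrow>\<^sub>L 'a"
  assumes r: "r > 0" and K: "K \<ge> 0" and p: "p \<in> M"
    and deriv: "\<And>y. y \<in> ball p r \<Longrightarrow> (P has_derivative blinfun_apply (P' y)) (at y)"
    and lip: "\<And>y z. y \<in> ball p r \<Longrightarrow> z \<in> ball p r \<Longrightarrow> norm (P' y - P' z) \<le> K * norm (y - z)"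
    and into: "\<And>y. y \<in> ball p r \<Longrightarrow> P y \<in> M"
    and fixed: "\<And>y. y \<in> ball p r \<Longrightarrow> y \<in> M \<Longrightarrow> P y = y"

text \<open>The retraction is \<open>\<psi>i \<circ> \<pi> \<circ> \<psi>\<close>, with
  \<open>\<pi>\<close> a linear projection onto the model subspace \<open>S\<close>. Its derivative
  is a composition of bounded Lipschitz factors and therefore Lipschitz.\<close>

lemma C3_embedded_submanifold_retraction:
  assumes "C3_embedded_submanifold M" "p \<in> M"
  obtains r K P P' where "C11_retraction M p r K P P'"
proof -
  from assms obtain U W and \<psi> \<psi>i :: "'a \<Rightarrow> 'a" and S where
    U: "open U" "p \<in> U" and W: "open W" and S: "subspace S"
    and "C3_on U \<psi>" "C3_on W \<psi>i" and img: "\<psi> ` U = W"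
    and inv: "\<And>x. x \<in> U \<Longrightarrow> \<psi>i (\<psi> x) = x" and MU: "\<psi> ` (M \<inter> U) = W \<inter> S"
    unfolding C3_embedded_submanifold_def by (elim ballE[of _ _ p]) (blast, blast)
  then obtain f g :: "'a \<Rightarrow> 'a \<Rightarrow>\<^sub>L 'a" where
    f: "\<And>x. x \<in> U \<Longrightarrow> (\<psi> has_derivative blinfun_apply (f x)) (at x)" "C2_on U f"
    and g: "\<And>x. x \<in> W \<Longrightarrow> (\<psi>i has_derivative blinfun_apply (g x)) (at x)" "C2_on W g"
    unfolding C3_on_def by blast
  have f1: "C1_on U f" and g1: "C1_on W g" using f g C2_on_imp_C1_on by auto
  have \<psi>1: "C1_on U \<psi>" unfolding C1_on_def using f f1 C1_on_imp_continuous_on by blast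
  obtain \<pi> where \<pi>: "linear \<pi>" "range \<pi> \<subseteq> S" "\<And>x. x \<in> S \<Longrightarrow> \<pi> x = x"
    using ex_linear_projection[OF S] by blast
  have bl: "bounded_linear \<pi>" using \<pi>(1) by (simp add: linear_conv_bounded_linear)
  define \<pi>b where "\<pi>b = Blinfun \<pi>"
  have \<pi>b: "blinfun_apply \<pi>b = \<pi>" by (simp add: \<pi>b_def bounded_linear_Blinfun_apply[OF bl])
  have \<psi>p: "\<psi> p \<in> W" "\<psi> p \<in> S" using MU U(2) assms(2) by auto
  then have \<pi>p: "\<pi> (\<psi> p) = \<psi> p" using \<pi>(3) by blast
  obtain rg Kg where rg: "rg > 0" "Kg \<ge> 0" "ball (\<psi> p) rg \<subseteq> W"
    and g_lip: "\<And>y z. y \<in> ball (\<psi> p) rg \<Longrightarrow> z \<in> ball (\<psi> p) rg \<Longrightarrow> norm (g y - g z) \<le> Kg * norm (y - z)"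
    and g_bd: "\<And>y. y \<in> ball (\<psi> p) rg \<Longrightarrow> norm (g y) \<le> norm (g (\<psi> p)) + Kg"
    using C1_on_locally_Lipschitz[OF g1 W \<psi>p(1)] by auto
  obtain rf Kf where rf: "rf > 0" "Kf \<ge> 0" "ball p rf \<subseteq> U"
    and f_lip: "\<And>y z. y \<in> ball p rf \<Longrightarrow> z \<in> ball p rf \<Longrightarrow> norm (f y - f z) \<le> Kf * norm (y - z)"
    and f_bd: "\<And>y. y \<in> ball p rf \<Longrightarrow> norm (f y) \<le> norm (f p) + Kf"
    using C1_on_locally_Lipschitz[OF f1 U] by auto
  obtain rp Kp where rp: "rp > 0" "Kp \<ge> 0" "ball p rp \<subseteq> U"
    and p_lip: "\<And>y z. y \<in> ball p rp \<Longrightarrow> z \<in> ball p rp \<Longrightarrow> norm (\<psi> y - \<psi> z) \<le> Kp * norm (y - z)"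
    using C1_on_locally_Lipschitz[OF \<psi>1 U] by auto
  define B where "B = norm \<pi>b * Kp"
  have B: "B \<ge> 0" using rp by (simp add: B_def)
  have q_lip: "norm (\<pi> (\<psi> y) - \<pi> (\<psi> z)) \<le> B * norm (y - z)" if "y \<in> ball p rp" "z \<in> ball p rp" for y z
  proof -
    have "norm (\<pi> (\<psi> y) - \<pi> (\<psi> z)) \<le> norm \<pi>b * norm (\<psi> y - \<psi> z)"
      using norm_blinfun[of \<pi>b "\<psi> y - \<psi> z"] by (simp add: \<pi>b linear_diff[OF \<pi>(1)])
    also have "\<dots> \<le> norm \<pi>b * (Kp * norm (y - z))" using p_lip[OF that] by (intro mult_left_mono) auto
    finally show ?thesis by (simp add: B_def mult_ac)
  qed
  \<comment> \<open>\<open>B\<close> is a Lipschitz constant of \<open>\<pi> \<circ> \<psi>\<close>,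
    so the last entry keeps \<open>\<pi> (\<psi> y)\<close> in the ball where \<open>g\<close> is
    controlled; the 1 added to \<open>B\<close> makes this strict and allows
    \<open>B = 0\<close>.\<close>
  define r where "r = min (min rf rp) (rg / (B + 1))"
  have "r > 0" "r \<le> rf" "r \<le> rp" "r \<le> rg / (B + 1)"
    using rf rp rg B by (auto simp: r_def min_le_iff_disj)
  then have r: "r > 0" "r \<le> rf" "r \<le> rp" "r * (B + 1) \<le> rg"
    using B by (auto simp: pos_le_divide_eq)
  have yU: "y \<in> ball p rf" "y \<in> ball p rp" "y \<in> U" if "y \<in> ball p r" for y
    using that r rf(3) by auto
  have yW: "\<pi> (\<psi> y) \<in> ball (\<psi> p) rg" if y: "y \<in> ball p r" for y
  proof -
    have "norm (\<pi> (\<psi> y) - \<psi> p) \<le> B * norm (y - p)"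
      using q_lip[of y p] yU[OF y] rp \<pi>p by simp
    also have "\<dots> \<le> B * r" using y B by (intro mult_left_mono) (auto simp: dist_norm norm_minus_commute)
    also have "\<dots> < rg" using r by (simp add: algebra_simps)
    finally show ?thesis by (simp add: dist_norm norm_minus_commute)
  qed
  have in_M: "\<psi>i z \<in> M \<inter> U" if "z \<in> W" "z \<in> S" for z
  proof -
    have "z \<in> \<psi> ` (M \<inter> U)" using MU that by simp
    then show ?thesis using inv by auto
  qed
  define P where "P y = \<psi>i (\<pi> (\<psi> y))" for y
  define X where "X y = g (\<pi> (\<psi> y)) o\<^sub>L \<pi>b" for y
  define P' where "P' y = X y o\<^sub>L f y" for y
  define BX where "BX = (norm (g (\<psi> p)) + Kg) * norm \<pi>b"
  define KX where "KX = Kg * B * norm \<pi>b"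
  have BX: "BX \<ge> 0" "KX \<ge> 0" using rg B by (auto simp: BX_def KX_def)
  have X_bd: "norm (X y) \<le> BX" if "y \<in> ball p r" for y
    unfolding X_def BX_def
    using order_trans[OF norm_blinfun_compose mult_right_mono[OF g_bd[OF yW[OF that]] norm_ge_zero]] .
  have X_lip: "norm (X y - X z) \<le> KX * norm (y - z)" if "y \<in> ball p r" "z \<in> ball p r" for y z
  proof -
    have "X y - X z = (g (\<pi> (\<psi> y)) - g (\<pi> (\<psi> z))) o\<^sub>L \<pi>b"
      unfolding X_def by (simp add: bounded_bilinear.diff_left[OF bounded_bilinear_blinfun_compose])
    then have "norm (X y - X z) \<le> norm (g (\<pi> (\<psi> y)) - g (\<pi> (\<psi> z))) * norm \<pi>b"
      by (simp add: norm_blinfun_compose)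
    also have "\<dots> \<le> (Kg * (B * norm (y - z))) * norm \<pi>b"
      using order_trans[OF g_lip[OF yW yW] mult_left_mono[OF q_lip[OF yU(2) yU(2)] rg(2)]] that
      by (intro mult_right_mono) auto
    finally show ?thesis by (simp add: KX_def mult_ac)
  qed
  define K where "K = BX * Kf + KX * (norm (f p) + Kf)"
  have "C11_retraction M p r K P P'"
  proof
    show "K \<ge> 0" using BX rf by (simp add: K_def)
    fix y assume y: "y \<in> ball p r"
    have "((\<lambda>y. \<pi> (\<psi> y)) has_derivative (\<lambda>v. \<pi> (f y v))) (at y)"
      using bounded_linear.has_derivative[OF bl f(1)[OF yU(3)[OF y]]] .
    moreover have "\<pi> (\<psi> y) \<in> W" using yW[OF y] rg(3) by blast
    ultimately have "(P has_derivative (\<lambda>v. g (\<pi> (\<psi> y)) (\<pi> (f y v)))) (at y)"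
      unfolding P_def[abs_def] using has_derivative_compose g(1) by blast
    moreover have "blinfun_apply (P' y) = (\<lambda>v. g (\<pi> (\<psi> y)) (\<pi> (f y v)))"
      by (simp add: P'_def X_def \<pi>b fun_eq_iff)
    ultimately show "(P has_derivative blinfun_apply (P' y)) (at y)" by simp
    have "\<pi> (\<psi> y) \<in> S" using \<pi>(2) by blast
    then show "P y \<in> M" unfolding P_def using in_M yW[OF y] rg(3) by blast
    show "P y = y" if "y \<in> M"
    proof -
      have "\<psi> y \<in> S" using MU that yU(3)[OF y] by blast
      then show ?thesis using \<pi>(3) inv yU(3)[OF y] by (simp add: P_def)
    qed
    fix z assume z: "z \<in> ball p r"
    have "P' y - P' z = (X y o\<^sub>L (f y - f z)) + ((X y - X z) o\<^sub>L f z)"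
      unfolding P'_def
      by (simp add: bounded_bilinear.diff_left[OF bounded_bilinear_blinfun_compose]
          bounded_bilinear.diff_right[OF bounded_bilinear_blinfun_compose])
    then have "norm (P' y - P' z) \<le> norm (X y) * norm (f y - f z) + norm (X y - X z) * norm (f z)"
      by (simp add: norm_blinfun_compose norm_triangle_mono)
    also have "\<dots> \<le> BX * (Kf * norm (y - z)) + (KX * norm (y - z)) * (norm (f p) + Kf)"
      using X_bd[OF y] f_lip[OF yU(1) yU(1), OF y z] X_lip[OF y z] f_bd[OF yU(1), OF z] BX
      by (intro add_mono mult_mono) auto
    finally show "norm (P' y - P' z) \<le> K * norm (y - z)" by (simp add: K_def algebra_simps)
  qed (use r assms(2) in auto)
  then show thesis by (rule that)
qed

section \<open>Chords, intrinsic distance and averaging maps\<close>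

context C11_retraction begin

lemma continuous_deriv: "continuous_on (ball p r) P'"
proof (rule lipschitz_on_continuous_on)
  show "K-lipschitz_on (ball p r) P'"
    using lip K by (intro lipschitz_onI) (auto simp: dist_norm)
qed

text \<open>Mean value inequality for \<open>P - P' z\<close>. When \<open>x\<close> and
  \<open>y\<close> are fixed by \<open>P\<close>, it says that \<open>P' z\<close> almost fixes the
  chord \<open>y - x\<close>; the base point \<open>z\<close> need not lie in
  \<open>S\<close>.\<close>

lemma increment_bound:
  assumes "convex S" "S \<subseteq> ball p r" "x \<in> S" "y \<in> S" and \<delta>: "\<And>v. v \<in> S \<Longrightarrow> norm (v - z) \<le> \<delta>"
    and z: "z \<in> ball p r"
  shows "norm (P y - P x - P' z (y - x)) \<le> K * \<delta> * norm (y - x)"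
proof -
  have "norm ((P y - P' z y) - (P x - P' z x)) \<le> (K * \<delta>) * norm (y - x)"
  proof (rule differentiable_bound[OF \<open>convex S\<close> _ _ \<open>y \<in> S\<close> \<open>x \<in> S\<close>])
    fix v assume v: "v \<in> S"
    then have vb: "v \<in> ball p r" using assms(2) by blast
    show "((\<lambda>y. P y - P' z y) has_derivative blinfun_apply (P' v - P' z)) (at v within S)"
      using has_derivative_at_withinI[OF deriv[OF vb]]
      by (auto intro!: derivative_eq_intros bounded_linear_imp_has_derivative blinfun.bounded_linear_right
          simp: blinfun.diff_left fun_eq_iff)
    have "norm (P' v - P' z) \<le> K * \<delta>"
      using lip[OF vb z] mult_left_mono[OF \<delta>[OF v] K] by linarith
    then show "onorm (blinfun_apply (P' v - P' z)) \<le> K * \<delta>" by (simp add: norm_blinfun.rep_eq)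
  qed
  then show ?thesis by (simp add: blinfun.diff_right algebra_simps)
qed

text \<open>The velocity \<open>D\<close> of the projected segment differs from \<open>e\<close> by
  \<open>O(norm e ^ 2)\<close>, but its integral is exactly \<open>e\<close>. The component along
  \<open>e\<close> thus contributes no excess length, and what remains is quadratic in the velocity
  error: \<open>norm e ^ 4 / norm e\<close>.\<close>

lemma projected_segment_length:
  assumes x: "x \<in> M" "x \<in> ball p r" and y: "y \<in> M" "y \<in> ball p r"
  obtains L where "L \<in> connecting_lengths M x y" "L \<le> norm (y - x) + K\<^sup>2 / 2 * norm (y - x) ^ 3"
proof -
  define e where "e = y - x"
  define q where "q t = x + t *\<^sub>R e" for t :: real
  define \<gamma> where "\<gamma> t = P (q t)" for t
  define D where "D t = P' (q t) e" for t
  have q: "q t \<in> closed_segment x y" if "t \<in> {0..1}" for t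
    unfolding in_segment q_def e_def
    by (rule exI[of _ t]) (use that in \<open>auto simp: algebra_simps\<close>)
  have seg: "closed_segment x y \<subseteq> ball p r"
    using x y by (intro closed_segment_subset) auto
  have qb: "q t \<in> ball p r" if "t \<in> {0..1}" for t using q[OF that] seg by blast
  have vd: "(\<gamma> has_vector_derivative D t) (at t)" if "t \<in> {0..1}" for t
  proof -
    have "(q has_derivative (\<lambda>h. h *\<^sub>R e)) (at t)"
      unfolding q_def by (auto intro!: derivative_eq_intros)
    from has_derivative_compose[OF this deriv[OF qb[OF that]]] show ?thesis
      by (simp add: has_vector_derivative_def \<gamma>_def[abs_def] D_def blinfun.scaleR_right)
  qed
  have contq: "continuous_on {0..1} q" unfolding q_def by (intro continuous_intros)
  have contD: "continuous_on {0..1} D"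
    unfolding D_def using contq qb
    by (intro continuous_intros continuous_on_compose2[OF continuous_deriv]) auto
  have vdD: "vector_derivative \<gamma> (at t) = D t" if "t \<in> {0..1}" for t
    using vd[OF that] vector_derivative_at by blast
  have C1: "\<gamma> C1_differentiable_on {0..1}"
    unfolding C1_differentiable_on_def using vd contD by blast
  have ends: "\<gamma> 0 = x" "\<gamma> 1 = y" using fixed x y by (auto simp: \<gamma>_def q_def e_def)
  have Dint: "(\<lambda>t. norm (D t)) integrable_on {0..1}"
    using contD by (intro integrable_continuous_real continuous_intros)
  have int: "(\<lambda>t. norm (vector_derivative \<gamma> (at t))) integrable_on {0..1}"
    using Dint by (rule integrable_eq) (simp add: vdD)
  have L: "integral {0..1} (\<lambda>t. norm (D t)) = integral {0..1} (\<lambda>t. norm (vector_derivative \<gamma> (at t)))"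
    by (rule integral_cong) (simp add: vdD)
  have "integral {0..1} (\<lambda>t. norm (D t)) \<in> connecting_lengths M x y"
    unfolding connecting_lengths_def mem_Collect_eq L
    by (rule exI[of _ \<gamma>])
       (use int ends C1_differentiable_imp_piecewise[OF C1] into qb in \<open>auto simp: \<gamma>_def\<close>)
  moreover have "integral {0..1} (\<lambda>t. norm (D t)) \<le> norm e + K\<^sup>2 / 2 * norm e ^ 3"
  proof (cases "e = 0")
    case True
    then show ?thesis by (simp add: D_def)
  next
    case False
    have hint: "(D has_integral e) {0..1}"
      using fundamental_theorem_of_calculus[of 0 1 \<gamma> D] vd ends
      by (auto simp: e_def intro: has_vector_derivative_at_within)
    have hint2: "((\<lambda>t. inner e (D t)) has_integral inner e e) {0..1}"
      using has_integral_linear[OF hint bounded_linear_inner_right] by (simp add: o_def)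
    have hint3: "((\<lambda>t. inner e (D t) / norm e + K\<^sup>2 / 2 * norm e ^ 3) has_integral
        inner e e / norm e + K\<^sup>2 / 2 * norm e ^ 3) {0..1}"
      using has_integral_add[OF has_integral_divide[OF hint2] has_integral_const_real[of "K\<^sup>2 / 2 * norm e ^ 3" 0 1]]
      by simp
    \<comment> \<open>From \<open>2 * norm e * norm (D t) \<le> (norm e)^2 + (norm (D t))^2\<close>,
      rewritten through \<open>norm (e - D t)\<close>: the first term integrates to
      \<open>norm e\<close>, the second is the cubic excess.\<close>
    have bound: "norm (D t) \<le> inner e (D t) / norm e + K\<^sup>2 / 2 * norm e ^ 3" if t: "t \<in> {0..1}" for t
    proof -
      have "norm (P y - P x - P' (q t) (y - x)) \<le> K * norm e * norm (y - x)"
      proof (rule increment_bound[OF convex_closed_segment seg _ _ _ qb[OF t]])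
        fix v assume "v \<in> closed_segment x y"
        then obtain s where s: "s \<in> {0..1}" "v = q s"
          by (auto simp: in_segment q_def e_def algebra_simps)
        then have "v - q t = (s - t) *\<^sub>R e" by (simp add: q_def algebra_simps)
        then show "norm (v - q t) \<le> norm e" using s t mult_right_mono[of "\<bar>s - t\<bar>" 1 "norm e"] by auto
      qed auto
      then have "norm (e - D t) \<le> K * (norm e)\<^sup>2"
        using fixed x y by (simp add: D_def e_def power2_eq_square mult_ac)
      then have "(norm (e - D t))\<^sup>2 \<le> (K * (norm e)\<^sup>2)\<^sup>2" by (intro power_mono) auto
      then have 1: "(norm (e - D t))\<^sup>2 \<le> K\<^sup>2 * norm e ^ 4" by (simp add: power_mult_distrib)
      have "0 \<le> (norm e - norm (D t))\<^sup>2" by simp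
      then have "2 * norm e * norm (D t) \<le> (norm e)\<^sup>2 + (norm (D t))\<^sup>2"
        by (simp add: power2_diff)
      also have "\<dots> = (norm (e - D t))\<^sup>2 + 2 * inner e (D t)"
        by (simp add: power2_norm_eq_inner inner_diff_left inner_diff_right inner_commute)
      also have "\<dots> \<le> K\<^sup>2 * norm e ^ 4 + 2 * inner e (D t)" using 1 by simp
      finally have "norm (D t) \<le> (K\<^sup>2 * norm e ^ 4 + 2 * inner e (D t)) / (2 * norm e)"
        using False by (simp add: pos_le_divide_eq mult_ac)
      also have "\<dots> = inner e (D t) / norm e + K\<^sup>2 / 2 * norm e ^ 3"
        using False by (simp add: field_simps power4_eq_xxxx power3_eq_cube)
      finally show ?thesis .
    qed
    have "integral {0..1} (\<lambda>t. norm (D t)) \<le> inner e e / norm e + K\<^sup>2 / 2 * norm e ^ 3"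
      by (rule has_integral_le[OF integrable_integral[OF Dint] hint3 bound])
    also have "inner e e / norm e = norm e"
      using False by (simp add: power2_norm_eq_inner[symmetric] power2_eq_square)
    finally show ?thesis .
  qed
  ultimately show thesis using that unfolding e_def by blast
qed

text \<open>Along an averaging map the intrinsic distances are known exactly. Chords are bounded
  above by them and below up to a cubic term, which are the hypotheses of
  \<open>almost_straight_curve\<close>.\<close>

lemma averaging_map_derivative:
  obtains \<delta> where "\<delta> > 0" "\<delta> \<le> r"
    "\<And>x x'. \<lbrakk>x \<in> M; x \<in> ball p \<delta>; x' \<in> M; x' \<in> ball p \<delta>\<rbrakk> \<Longrightarrow>
        norm (x' - x) \<le> riem_dist M x x' \<and> riem_dist M x x' \<le> 2 * norm (x' - x)"
    "\<And>x x' g t. \<lbrakk>x \<in> M; x \<in> ball p \<delta>; x' \<in> M; x' \<in> ball p \<delta>; x \<noteq> x'; averaging_map M x x' g; t \<in> {0..1}\<rbrakk> \<Longrightarrow>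
       \<exists>d. (g has_vector_derivative d) (at t within {0..1}) \<and>
           norm (d - (x' - x)) \<le> 8 * K * (riem_dist M x x')\<^sup>2"
proof -
  \<comment> \<open>If no path joins two points, their distance is the unspecified value of \<open>Inf {}\<close>. An averaging
    map between points at smaller distance cannot leave the component of its end points.\<close>
  define c where "c = Inf ({} :: real set)"
  \<comment> \<open>An averaging map starts within \<open>\<delta>\<close> of \<open>p\<close> and
    has length below \<open>4 * \<delta>\<close>, hence \<open>r / 5\<close>. The second entry keeps
    the cubic excess below the chord, and \<open>c / 4\<close> puts all distances that occur below
    \<open>c\<close>.\<close>
  define \<delta> where "\<delta> = min (r / 5) (min (1 / (2 * (K + 1))) (if c > 0 then c / 4 else 1))"
  have "\<delta> > 0" "\<delta> \<le> r / 5" "\<delta> \<le> 1 / (2 * (K + 1))" "c > 0 \<Longrightarrow> \<delta> \<le> c / 4"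
    using r K by (auto simp: \<delta>_def min_le_iff_disj)
  then have \<delta>: "\<delta> > 0" "5 * \<delta> \<le> r" "\<delta> \<le> 1 / (2 * (K + 1))" "c > 0 \<Longrightarrow> 4 * \<delta> \<le> c"
    by auto
  have K\<delta>: "2 * K * \<delta> \<le> 1"
  proof -
    have "\<delta> * (2 * (K + 1)) \<le> 1" using \<delta>(3) K by (simp add: pos_le_divide_eq)
    then show ?thesis using \<delta>(1) by (simp add: algebra_simps)
  qed
  have near: "connecting_lengths M x x' \<noteq> {}" "norm (x' - x) \<le> riem_dist M x x'"
      "riem_dist M x x' \<le> norm (x' - x) + K\<^sup>2 / 2 * norm (x' - x) ^ 3"
    if x: "x \<in> M" "x \<in> ball p r" "x' \<in> M" "x' \<in> ball p r" for x x'
  proof -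
    obtain L where L: "L \<in> connecting_lengths M x x'" "L \<le> norm (x' - x) + K\<^sup>2 / 2 * norm (x' - x) ^ 3"
      using projected_segment_length[OF x] by blast
    show ne: "connecting_lengths M x x' \<noteq> {}" using L by blast
    show "norm (x' - x) \<le> riem_dist M x x'" using norm_le_riem_dist[OF ne] .
    show "riem_dist M x x' \<le> norm (x' - x) + K\<^sup>2 / 2 * norm (x' - x) ^ 3"
      using riem_dist_le[OF L(1)] L(2) by linarith
  qed
  have near2: "norm (x' - x) \<le> riem_dist M x x' \<and> riem_dist M x x' \<le> 2 * norm (x' - x)"
    and small: "norm (x' - x) < 2 * \<delta>"
    if x: "x \<in> M" "x \<in> ball p \<delta>" "x' \<in> M" "x' \<in> ball p \<delta>" for x x'
  proof -
    have xr: "x \<in> ball p r" "x' \<in> ball p r" using x \<delta> by auto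
    show sm: "norm (x' - x) < 2 * \<delta>"
      using x norm_triangle_ineq[of "x' - p" "p - x"] by (simp add: dist_norm norm_minus_commute)
    have "(K * norm (x' - x)) * (K * norm (x' - x)) \<le> 1 * 1"
      using mult_left_mono[OF less_imp_le[OF sm] K] K\<delta> K by (intro mult_mono) auto
    then have "K\<^sup>2 * norm (x' - x) ^ 2 * norm (x' - x) \<le> 1 * norm (x' - x)"
      by (intro mult_right_mono) (auto simp: power2_eq_square mult_ac)
    then have "K\<^sup>2 / 2 * norm (x' - x) ^ 3 \<le> norm (x' - x)"
      by (simp add: power3_eq_cube power2_eq_square mult_ac)
        (smt (verit) norm_ge_zero)
    then show "norm (x' - x) \<le> riem_dist M x x' \<and> riem_dist M x x' \<le> 2 * norm (x' - x)"
      using near(2,3)[OF x(1) xr(1) x(3) xr(2)] by linarith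
  qed
  show thesis
  proof
    show "\<delta> \<le> r" using \<delta> by linarith
    fix x x' g and t :: real
    assume x: "x \<in> M" "x \<in> ball p \<delta>" "x' \<in> M" "x' \<in> ball p \<delta>" "x \<noteq> x'"
      and g: "averaging_map M x x' g" and t: "t \<in> {0..1}"
    define L where "L = riem_dist M x x'"
    have "norm (x' - x) > 0" using x(5) by simp
    then have L: "L > 0" "L < 4 * \<delta>"
      using near2[OF x(1-4)] small[OF x(1-4)] unfolding L_def by (safe, linarith+)
    have gM: "g s \<in> M" and g0: "g 0 = x" and g1: "g 1 = x'"
      and gL: "riem_dist M (g s) (g u) = \<bar>s - u\<bar> * L" if "s \<in> {0..1}" "u \<in> {0..1}" for s u
      using g that unfolding averaging_map_def L_def by auto
    have up: "norm (g u - g s) \<le> L * \<bar>u - s\<bar>" if su: "s \<in> {0..1}" "u \<in> {0..1}" for s u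
    proof (cases "s = u")
      case False
      have "connecting_lengths M (g s) (g u) \<noteq> {}"
      proof
        assume "connecting_lengths M (g s) (g u) = {}"
        then have c: "c = \<bar>s - u\<bar> * L" using gL[OF su] by (simp add: riem_dist_eq c_def)
        then have "c > 0" using False L by simp
        moreover have "c \<le> L" unfolding c using su L by (intro mult_left_le_one_le) auto
        ultimately show False using \<delta>(4) L(2) by linarith
      qed
      from norm_le_riem_dist[OF this] show ?thesis
        using gL[OF su] by (simp add: mult.commute abs_minus_commute)
    qed simp
    have gb: "g s \<in> ball p r" if s: "s \<in> {0..1}" for s
    proof -
      have "norm (g s - x) \<le> L * \<bar>s - 0\<bar>" using up[of 0 s] s g0[OF s s] by simp
      also have "\<dots> \<le> L" using s L by (simp add: mult_left_le)
      finally have "norm (g s - x) < 4 * \<delta>" using L by simp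
      moreover have "norm (x - p) < \<delta>" using x by (simp add: dist_norm norm_minus_commute)
      ultimately have "norm (g s - p) < r"
        using norm_triangle_ineq[of "g s - x" "x - p"] \<delta>(2) by simp
      then show ?thesis by (simp add: dist_norm norm_minus_commute)
    qed
    interpret almost_straight_curve g L "K * L\<^sup>2"
    proof
      fix s u :: real assume su: "s \<in> {0..1}" "u \<in> {0..1}"
      define l where "l = L * \<bar>u - s\<bar>"
      define n where "n = norm (g u - g s)"
      have n: "0 \<le> n" "n \<le> l" using up[OF su] by (auto simp: n_def l_def)
      have "l \<le> n + K\<^sup>2 / 2 * n ^ 3"
        using near(3)[OF gM gb gM gb, OF su(1) su(1) su(1) su(2) su(2) su(2)] gL[OF su]
        by (simp add: n_def l_def mult.commute abs_minus_commute)
      also have "\<dots> \<le> n + K\<^sup>2 / 2 * l ^ 3" using n by (intro add_left_mono mult_left_mono power_mono) auto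
      finally have "l - n \<le> K\<^sup>2 / 2 * l ^ 3" by simp
      \<comment> \<open>Multiplication by \<open>l + n \<le> 2 * l\<close> turns the cubic defect of
        lengths into a fourth order defect of squares.\<close>
      then have "(l - n) * (l + n) \<le> (K\<^sup>2 / 2 * l ^ 3) * (2 * l)"
        using n by (intro mult_mono) auto
      then have "l\<^sup>2 - K\<^sup>2 * l ^ 4 \<le> n\<^sup>2"
        by (simp add: algebra_simps power2_eq_square power3_eq_cube power4_eq_xxxx)
      then show "(L * \<bar>u - s\<bar>)\<^sup>2 - (K * L\<^sup>2)\<^sup>2 * (u - s) ^ 4 \<le> (norm (g u - g s))\<^sup>2"
        by (simp add: l_def n_def power_mult_distrib mult.assoc)
    qed (use L K up in auto)
    show "\<exists>d. (g has_vector_derivative d) (at t within {0..1}) \<and>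
        norm (d - (x' - x)) \<le> 8 * K * (riem_dist M x x')\<^sup>2"
      using derivative_near_chord[OF t] g0[OF t t] g1[OF t t] by (simp add: L_def mult.assoc)
  qed (use \<delta> near2 in auto)
qed

end

section \<open>Curves in the preimage of a convex set\<close>

text \<open>Based on the identity \<open>B y - B z = B y (A z - A y) B z\<close>. Its right side
  still contains \<open>B y\<close>; once the middle factor times \<open>norm (B z)\<close> is below
  1/2, the identity itself gives \<open>norm (B y) \<le> 2 * norm (B z)\<close>, and the estimate
  closes.\<close>

lemma continuous_on_blinfun_inverse:
  fixes A B :: "'z::topological_space \<Rightarrow> ('a::real_normed_vector \<Rightarrow>\<^sub>L 'a)"
  assumes A: "continuous_on S A"
    and inv: "\<And>y v. y \<in> S \<Longrightarrow> A y (B y v) = v" "\<And>y v. y \<in> S \<Longrightarrow> B y (A y v) = v"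
  shows "continuous_on S B"
  unfolding continuous_on_def
proof
  fix z assume z: "z \<in> S"
  define c where "c = norm (B z)"
  define \<delta> where "\<delta> y = norm (A y - A z)" for y
  have "(A \<longlongrightarrow> A z) (at z within S)" using A z by (simp add: continuous_on_def)
  then have \<delta>: "(\<delta> \<longlongrightarrow> 0) (at z within S)"
    unfolding \<delta>_def[abs_def] by (simp add: LIM_zero_iff tendsto_norm_zero)
  then have c\<delta>: "((\<lambda>y. \<delta> y * c) \<longlongrightarrow> 0) (at z within S)"
    by (rule tendsto_mult_left_zero)
  have "\<forall>\<^sub>F y in at z within S. \<delta> y * c < 1/2"
    using order_tendstoD(2)[OF c\<delta>, of "1/2"] by simp
  moreover have "\<forall>\<^sub>F y in at z within S. y \<in> S" by (auto simp: eventually_at_filter)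
  ultimately have "\<forall>\<^sub>F y in at z within S. norm (B y - B z) \<le> 2 * c * (\<delta> y * c)"
  proof eventually_elim
    case (elim y)
    have eq: "B y - B z = B y o\<^sub>L ((A z - A y) o\<^sub>L B z)"
      by (rule blinfun_eqI) (simp add: blinfun.diff_left blinfun.diff_right inv z elim)
    have "norm (B y - B z) \<le> norm (B y) * norm ((A z - A y) o\<^sub>L B z)"
      unfolding eq by (rule norm_blinfun_compose)
    also have "\<dots> \<le> norm (B y) * (\<delta> y * c)"
      unfolding \<delta>_def c_def norm_minus_commute[of "A y"]
      by (intro mult_left_mono norm_blinfun_compose) auto
    finally have le: "norm (B y - B z) \<le> norm (B y) * (\<delta> y * c)" .
    also have "\<dots> \<le> norm (B y) * (1/2)" using elim by (intro mult_left_mono) auto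
    finally have "norm (B y) \<le> 2 * c"
      using norm_triangle_sub[of "B y" "B z"] unfolding c_def by linarith
    then have "norm (B y) * (\<delta> y * c) \<le> 2 * c * (\<delta> y * c)"
      by (intro mult_right_mono) (auto simp: \<delta>_def c_def)
    then show ?case using le by linarith
  qed
  moreover have "((\<lambda>y. 2 * c * (\<delta> y * c)) \<longlongrightarrow> 0) (at z within S)"
    using c\<delta> by (rule tendsto_mult_right_zero)
  ultimately have "((\<lambda>y. B y - B z) \<longlongrightarrow> 0) (at z within S)" by (rule Lim_null_comparison)
  then show "(B \<longlongrightarrow> B z) (at z within S)" by (simp add: LIM_zero_iff)
qed

text \<open>Adds to the inverse function theorem that the derivative of the inverse is continuous in
  operator norm: it is the inverse of \<open>f' (g y)\<close>, which depends continuously on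
  \<open>y\<close>.\<close>

lemma inverse_function_theorem_C1:
  fixes f :: "'a::euclidean_space \<Rightarrow> 'a" and f' :: "'a \<Rightarrow> ('a \<Rightarrow>\<^sub>L 'a)"
  assumes "open U" and derf: "\<And>x. x \<in> U \<Longrightarrow> (f has_derivative (blinfun_apply (f' x))) (at x)"
    and contf: "continuous_on U f'" and "x0 \<in> U" and invf: "invf o\<^sub>L f' x0 = id_blinfun"
  obtains U' V g g' where "open U'" "U' \<subseteq> U" "x0 \<in> U'" "open V" "f x0 \<in> V" "homeomorphism U' V f g"
    "\<And>y. y \<in> V \<Longrightarrow> (g has_derivative (blinfun_apply (g' y))) (at y)" "continuous_on V g'"
    "\<And>y v. y \<in> V \<Longrightarrow> g' y (f' (g y) v) = v"
proof (rule inverse_function_theorem[OF assms])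
  fix U' V g g'
  assume *: "open U'" "U' \<subseteq> U" "x0 \<in> U'" "open V" "f x0 \<in> V" "homeomorphism U' V f g"
    "\<And>y. y \<in> V \<Longrightarrow> (g has_derivative (g' y)) (at y)"
    "\<And>y. y \<in> V \<Longrightarrow> g' y = inv (blinfun_apply (f'(g y)))"
    "\<And>y. y \<in> V \<Longrightarrow> bij (blinfun_apply (f'(g y)))"
  define h where "h y = Blinfun (g' y)" for y
  have h: "blinfun_apply (h y) = g' y" if "y \<in> V" for y
    unfolding h_def using *(7)[OF that] by (intro bounded_linear_Blinfun_apply has_derivative_bounded_linear)
  have i1: "f' (g y) (h y v) = v" if "y \<in> V" for y v
    using h[OF that] *(8,9)[OF that] by (simp add: bij_is_surj surj_f_inv_f)
  have i2: "h y (f' (g y) v) = v" if "y \<in> V" for y v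
    using h[OF that] *(8,9)[OF that] by (simp add: bij_is_inj inv_f_f)
  have g: "continuous_on V g" "g ` V = U'" using *(6) by (auto simp: homeomorphism_def)
  have "continuous_on V (\<lambda>y. f' (g y))"
    by (rule continuous_on_compose2[OF contf g(1)]) (use g(2) *(2) in auto)
  then have "continuous_on V h" by (rule continuous_on_blinfun_inverse) (use i1 i2 in auto)
  then show thesis using that[OF *(1-6), of h] *(7) h i2 by auto
qed

text \<open>For given \<open>(a, q)\<close> the equation
  \<open>H (a + w1 u) - \<sigma> u = q\<close> is solved for \<open>u\<close>. By the splitting, its
  derivative in \<open>u\<close> at \<open>(p, 0)\<close> is the identity, so the inverse function
  theorem applies to \<open>(a, u) \<mapsto> (a, H (a + w1 u) - \<sigma> u)\<close>.\<close>

lemma implicit_correction: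
  fixes H :: "'a::euclidean_space \<Rightarrow> 'b::euclidean_space" and H' :: "'a \<Rightarrow> 'a \<Rightarrow>\<^sub>L 'b"
    and w1 :: "'b \<Rightarrow>\<^sub>L 'a" and \<sigma> :: "'b \<Rightarrow>\<^sub>L 'b"
  assumes \<Omega>: "open \<Omega>" "p \<in> \<Omega>"
    and der: "\<And>x. x \<in> \<Omega> \<Longrightarrow> (H has_derivative (blinfun_apply (H' x))) (at x)"
    and cont: "continuous_on \<Omega> H'" and split: "\<And>u. H' p (w1 u) - \<sigma> u = u"
  obtains N N0 U U' where "open N" "(p, H p) \<in> N" "open N0" "p \<in> N0"
    "\<And>z. z \<in> N \<Longrightarrow> (U has_derivative (blinfun_apply (U' z))) (at z)" "continuous_on N U'"
    "\<And>\<alpha> \<beta>. U' (p, H p) (\<alpha>, \<beta>) = \<beta> - H' p \<alpha>"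
    "\<And>a q. (a, q) \<in> N \<Longrightarrow> H (a + w1 (U (a, q))) = q + \<sigma> (U (a, q))"
    "\<And>a. a \<in> N0 \<Longrightarrow> U (a, H a) = 0"
proof -
  \<comment> \<open>With the linear ingredients as bounded linear functions, the derivative
    \<open>f'\<close> is built from continuous operations. The map \<open>k\<close> inverts the
    triangular derivative \<open>(\<alpha>, \<beta>) \<mapsto> (\<alpha>, H' p \<alpha> +
    \<beta>)\<close> at \<open>(p, 0)\<close>.\<close>
  define l :: "('a \<times> 'b) \<Rightarrow>\<^sub>L 'a" where "l = Blinfun (\<lambda>z. fst z + w1 (snd z))"
  define s :: "('a \<times> 'b) \<Rightarrow>\<^sub>L 'b" where "s = Blinfun (\<lambda>z. \<sigma> (snd z))"
  define i :: "'b \<Rightarrow>\<^sub>L ('a \<times> 'b)" where "i = Blinfun (\<lambda>b. (0, b))"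
  define j :: "('a \<times> 'b) \<Rightarrow>\<^sub>L ('a \<times> 'b)" where "j = Blinfun (\<lambda>z. (fst z, 0))"
  define k :: "('a \<times> 'b) \<Rightarrow>\<^sub>L ('a \<times> 'b)" where "k = Blinfun (\<lambda>z. (fst z, snd z - H' p (fst z)))"
  have l: "blinfun_apply l = (\<lambda>z. fst z + w1 (snd z))"
    unfolding l_def by (intro bounded_linear_Blinfun_apply bounded_linear_intros)
  have s: "blinfun_apply s = (\<lambda>z. \<sigma> (snd z))"
    unfolding s_def by (intro bounded_linear_Blinfun_apply bounded_linear_intros)
  have i: "blinfun_apply i = (\<lambda>b. (0, b))"
    unfolding i_def by (intro bounded_linear_Blinfun_apply bounded_linear_Pair bounded_linear_intros)
  have j: "blinfun_apply j = (\<lambda>z. (fst z, 0))"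
    unfolding j_def by (intro bounded_linear_Blinfun_apply bounded_linear_Pair bounded_linear_intros)
  have k: "blinfun_apply k = (\<lambda>z. (fst z, snd z - H' p (fst z)))"
    unfolding k_def by (intro bounded_linear_Blinfun_apply bounded_linear_Pair bounded_linear_intros)
  define f where "f z = i (H (l z) - s z) + j z" for z
  define f' where "f' z = (i o\<^sub>L ((H' (l z) o\<^sub>L l) - s)) + j" for z
  have f: "f (a, u) = (a, H (a + w1 u) - \<sigma> u)" for a u by (simp add: f_def i j l s)
  have f': "f' (a, u) (\<alpha>, \<beta>) = (\<alpha>, H' (a + w1 u) (\<alpha> + w1 \<beta>) - \<sigma> \<beta>)" for a u \<alpha> \<beta>
    by (simp add: f'_def blinfun.add_left blinfun.diff_left i j l s)
  have l\<Omega>: "open (l -` \<Omega>)"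
    using \<Omega>(1) by (intro open_vimage linear_continuous_on blinfun.bounded_linear_right)
  have derf: "(f has_derivative (blinfun_apply (f' z))) (at z)" if "z \<in> l -` \<Omega>" for z
  proof -
    have "((\<lambda>z. H (l z)) has_derivative (\<lambda>v. H' (l z) (l v))) (at z)"
      using that der
      by (intro has_derivative_compose[of l "blinfun_apply l" z UNIV H]
          bounded_linear_imp_has_derivative blinfun.bounded_linear_right) auto
    then have "((\<lambda>z. H (l z) - s z) has_derivative (\<lambda>v. H' (l z) (l v) - s v)) (at z)"
      by (intro has_derivative_diff bounded_linear_imp_has_derivative blinfun.bounded_linear_right)
    then have "((\<lambda>z. i (H (l z) - s z)) has_derivative (\<lambda>v. i (H' (l z) (l v) - s v))) (at z)"
      by (rule bounded_linear.has_derivative[OF blinfun.bounded_linear_right])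
    then have "(f has_derivative (\<lambda>v. i (H' (l z) (l v) - s v) + j v)) (at z)"
      unfolding f_def[abs_def]
      by (intro has_derivative_add bounded_linear_imp_has_derivative blinfun.bounded_linear_right)
    moreover have "blinfun_apply (f' z) = (\<lambda>v. i (H' (l z) (l v) - s v) + j v)"
      by (simp add: f'_def fun_eq_iff blinfun.add_left blinfun.diff_left)
    ultimately show ?thesis by simp
  qed
  have contf: "continuous_on (l -` \<Omega>) f'"
  proof -
    have "continuous_on (l -` \<Omega>) (\<lambda>z. H' (l z))"
      by (rule continuous_on_compose2[OF cont])
         (auto intro: linear_continuous_on blinfun.bounded_linear_right)
    then show ?thesis unfolding f'_def
      by (intro continuous_intros
          bounded_bilinear.continuous_on[OF bounded_bilinear_blinfun_compose])
  qed
  have split': "H' p (w1 u) = u + \<sigma> u" for u using split[of u] by (simp add: algebra_simps)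
  have "k o\<^sub>L f' (p, 0) = id_blinfun"
    by (rule blinfun_eqI) (auto simp: k f' blinfun.add_right split')
  moreover have "(p, 0) \<in> l -` \<Omega>" using \<Omega>(2) by (simp add: l)
  ultimately obtain U1 V g g' where g: "open U1" "U1 \<subseteq> l -` \<Omega>" "(p, 0) \<in> U1" "open V" "f (p, 0) \<in> V"
    "homeomorphism U1 V f g"
    "\<And>y. y \<in> V \<Longrightarrow> (g has_derivative (blinfun_apply (g' y))) (at y)" "continuous_on V g'"
    "\<And>y v. y \<in> V \<Longrightarrow> g' y (f' (g y) v) = v"
    using inverse_function_theorem_C1[OF l\<Omega> derf contf, of "(p, 0)" k] by blast
  have fp: "f (p, 0) = (p, H p)" by (simp add: f)
  have gf: "g (f z) = z" if "z \<in> U1" for z using g(6) that by (auto simp: homeomorphism_def)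
  have fg: "f (g z) = z" if "z \<in> V" for z using g(6) that by (auto simp: homeomorphism_def)
  define sb :: "('a \<times> 'b) \<Rightarrow>\<^sub>L 'b" where "sb = Blinfun snd"
  have sb: "blinfun_apply sb = snd"
    unfolding sb_def by (intro bounded_linear_Blinfun_apply bounded_linear_snd)
  show thesis
  proof (rule that[of V "(\<lambda>a. (a, 0)) -` U1" "\<lambda>z. snd (g z)" "\<lambda>z. sb o\<^sub>L g' z"])
    show "open ((\<lambda>a. (a, 0)) -` U1)" using g(1) by (intro open_vimage continuous_intros)
    show "((\<lambda>z. snd (g z)) has_derivative blinfun_apply (sb o\<^sub>L g' z)) (at z)" if "z \<in> V" for z
      using has_derivative_snd[OF g(7)[OF that]] by (simp add: blinfun_compose.rep_eq sb o_def)
    show "continuous_on V (\<lambda>z. sb o\<^sub>L g' z)"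
      using g(8) by (intro continuous_intros bounded_bilinear.continuous_on[OF bounded_bilinear_blinfun_compose])
    show "(sb o\<^sub>L g' (p, H p)) (\<alpha>, \<beta>) = \<beta> - H' p \<alpha>" for \<alpha> \<beta>
    proof -
      have "f' (p, 0) (\<alpha>, \<beta> - H' p \<alpha>) = (\<alpha>, \<beta>)"
        by (simp add: f' blinfun.add_right split')
      then have "g' (p, H p) (\<alpha>, \<beta>) = (\<alpha>, \<beta> - H' p \<alpha>)"
        using g(9)[OF g(5), of "(\<alpha>, \<beta> - H' p \<alpha>)"] gf[OF g(3)] fp by simp
      then show ?thesis by (simp add: sb)
    qed
    show "H (a + w1 (snd (g (a, q)))) = q + \<sigma> (snd (g (a, q)))" if "(a, q) \<in> V" for a q
      using fg[OF that] f[of "fst (g (a, q))" "snd (g (a, q))"] by (auto simp: algebra_simps)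
    \<comment> \<open>Here \<open>(a, H a)\<close> is the image of \<open>(a, 0)\<close>, and
      \<open>g\<close> inverts \<open>f\<close> on \<open>U1\<close>.\<close>
    show "snd (g (a, H a)) = 0" if "a \<in> (\<lambda>a. (a, 0)) -` U1" for a
      using gf[of "(a, 0)"] that by (simp add: f blinfun.zero_right)
  qed (use g fp in auto)
qed

section \<open>The pushed chord and its correction\<close>

lemma ex_linear_small_bound:
  fixes a b :: real
  assumes "a \<ge> 0" "b > 0"
  obtains d where "d > 0" "a * d < b"
proof
  show "b / (a + 1) > 0" using assms by simp
  show "a * (b / (a + 1)) < b" using assms by (simp add: field_simps)
qed

text \<open>The constants are chosen in the order \<open>\<kappa>\<close> (push),
  \<open>\<eta>\<close> (accuracy of the linearization, depending on \<open>\<kappa>\<close>),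
  \<open>r\<close>. The correction has velocity \<open>O(\<eta> n)\<close> and vanishes at both
  ends, so it is small relative to the push \<open>\<mu> t\<close>. The interval
  \<open>{-1<..<2}\<close> supplies the open neighborhood of \<open>{0..1}\<close> required of a
  smooth curve segment.\<close>

lemma curve_in_preimage_of_convex:
  fixes H :: "'a::euclidean_space \<Rightarrow> 'b::euclidean_space" and H' :: "'a \<Rightarrow> 'a \<Rightarrow>\<^sub>L 'b"
  assumes \<Omega>: "open \<Omega>" "p \<in> \<Omega>"
    and der: "\<And>x. x \<in> \<Omega> \<Longrightarrow> (H has_derivative (blinfun_apply (H' x))) (at x)"
    and cont: "continuous_on \<Omega> H'"
    and D: "convex D" "H p \<in> D"
    and cq: "\<And>y. y \<in> normal_cone D (H p) \<Longrightarrow> (\<And>v. inner y (H' p v) = 0) \<Longrightarrow> y = 0"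
    and \<epsilon>: "\<epsilon> > 0"
  shows "\<exists>r>0. \<forall>x\<in>ball p r. \<forall>x'\<in>ball p r. H x \<in> D \<longrightarrow> H x' \<in> D \<longrightarrow>
    (\<exists>c c'. c 0 = x \<and> c 1 = x' \<and> continuous_on {-1<..<2} c' \<and>
      (\<forall>t\<in>{-1<..<2}. (c has_vector_derivative c' t) (at t) \<and> c t \<in> ball p \<epsilon>) \<and>
      (\<forall>t\<in>{0..1}. H (c t) \<in> D \<and> norm (c' t - (x' - x)) \<le> \<epsilon> * norm (x' - x)))"
proof -
  define A where "A = H' p"
  obtain w0 and w1f :: "'b \<Rightarrow> 'a" and \<sigma>f :: "'b \<Rightarrow> 'b" and \<rho> where lin: "linear w1f" "linear \<sigma>f" and \<rho>: "\<rho> > 0"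
    and split: "\<And>u. A (w1f u) - \<sigma>f u = u"
    and inD: "\<And>u. norm (\<sigma>f u) \<le> \<rho> \<Longrightarrow> H p + A w0 + \<sigma>f u \<in> D"
    using constraint_qualification_splitting[OF bounded_linear.linear[OF blinfun.bounded_linear_right] D, of A]
      cq unfolding A_def by metis
  define w1 where "w1 = Blinfun w1f"
  define \<sigma> where "\<sigma> = Blinfun \<sigma>f"
  have w1: "blinfun_apply w1 = w1f" and \<sigma>: "blinfun_apply \<sigma> = \<sigma>f"
    using lin by (simp_all add: w1_def \<sigma>_def bounded_linear_Blinfun_apply linear_conv_bounded_linear)
  obtain N N0 U U' where N: "open N" "(p, H p) \<in> N" "open N0" "p \<in> N0"
    and derU: "\<And>z. z \<in> N \<Longrightarrow> (U has_derivative (blinfun_apply (U' z))) (at z)"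
    and contU': "continuous_on N U'"
    and U'p: "\<And>\<alpha> \<beta>. U' (p, H p) (\<alpha>, \<beta>) = \<beta> - A \<alpha>"
    and HU: "\<And>a q. (a, q) \<in> N \<Longrightarrow> H (a + w1 (U (a, q))) = q + \<sigma> (U (a, q))"
    and U0: "\<And>a. a \<in> N0 \<Longrightarrow> U (a, H a) = 0"
    using implicit_correction[OF \<Omega> der cont, of w1 \<sigma>] split unfolding A_def w1 \<sigma> by metis
  define d0 where "d0 = H p + A w0"
  define nA where "nA = norm A"
  define W where "W = norm w0"
  have nA: "nA \<ge> 0" and W: "W \<ge> 0" by (auto simp: nA_def W_def)
  have A_le: "norm (A v) \<le> nA * norm v" for v unfolding nA_def by (rule norm_blinfun)
  \<comment> \<open>Collects the factors in the bound \<open>\<eta> * C1 * n\<close> for the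
    velocity of the correction, see \<open>u'_le\<close>.\<close>
  define C1 where "C1 = 6 + (1 + nA) * (1 + W)"
  have C1: "C1 > 0" using nA W by (simp add: C1_def add_pos_nonneg)
  \<comment> \<open>The push changes the velocity by at most \<open>\<kappa> * n * W\<close>, which
    takes half of the allowed error.\<close>
  obtain \<kappa>1 where \<kappa>1: "\<kappa>1 > 0" "W * \<kappa>1 < \<epsilon> / 2" by (rule ex_linear_small_bound[OF W, of "\<epsilon>/2"]) (use \<epsilon> in auto)
  define \<kappa> where "\<kappa> = min 1 \<kappa>1"
  have \<kappa>: "0 < \<kappa>" "\<kappa> \<le> 1" using \<kappa>1 by (auto simp: \<kappa>_def)
  have \<kappa>W: "W * \<kappa> \<le> \<epsilon> / 2"
    using mult_left_mono[of \<kappa> \<kappa>1 W] W \<kappa>1 by (simp add: \<kappa>_def)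
  \<comment> \<open>The other half of the error is left to the correction; \<open>\<eta>2\<close>
    below makes \<open>\<sigma>\<close> of the correction at most
    \<open>\<rho> * \<mu> t\<close>.\<close>
  obtain \<eta>1 where \<eta>1: "\<eta>1 > 0" "(norm w1 * C1) * \<eta>1 < \<epsilon> / 2"
    by (rule ex_linear_small_bound[of "norm w1 * C1" "\<epsilon>/2"]) (use \<epsilon> C1 in auto)
  obtain \<eta>2 where \<eta>2: "\<eta>2 > 0" "(norm \<sigma> * 2 * C1) * \<eta>2 < \<rho> * \<kappa>"
    by (rule ex_linear_small_bound[of "norm \<sigma> * 2 * C1" "\<rho> * \<kappa>"]) (use \<rho> \<kappa> C1 in auto)
  define \<eta> where "\<eta> = min 1 (min \<eta>1 \<eta>2)"
  have \<eta>: "0 < \<eta>" "\<eta> \<le> 1" "\<eta> \<le> \<eta>1" "\<eta> \<le> \<eta>2" using \<eta>1 \<eta>2 by (auto simp: \<eta>_def)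
  have \<eta>w: "norm w1 * C1 * \<eta> \<le> \<epsilon> / 2"
    using mult_left_mono[OF \<eta>(3), of "norm w1 * C1"] C1 \<eta>1(2) by simp
  have \<eta>\<sigma>: "norm \<sigma> * 2 * C1 * \<eta> \<le> \<rho> * \<kappa>"
    using mult_left_mono[OF \<eta>(4), of "norm \<sigma> * 2 * C1"] C1 \<eta>2(2)
    by (meson less_imp_le mult_nonneg_nonneg norm_ge_zero order_trans zero_le_numeral)

  have contU: "isCont U (p, H p)" using derU[OF N(2)] has_derivative_continuous by blast
  have Up: "U (p, H p) = 0" using U0 N by blast
  obtain \<delta> where \<delta>: "\<delta> > 0" "ball (p, H p) \<delta> \<subseteq> N"
    and \<delta>U': "\<And>z. z \<in> ball (p, H p) \<delta> \<Longrightarrow> norm (U' z - U' (p, H p)) \<le> \<eta>"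
    and \<delta>E: "\<And>z. z \<in> ball (p, H p) \<delta> \<Longrightarrow> fst z + w1 (U z) \<in> ball p \<epsilon>"
  proof -
    have "isCont U' (p, H p)" using contU' N continuous_on_eq_continuous_at by blast
    then obtain e1 where e1: "e1 > 0" "\<And>z. dist z (p, H p) < e1 \<Longrightarrow> dist (U' z) (U' (p, H p)) < \<eta>"
      unfolding continuous_at_eps_delta using \<eta>(1) by blast
    have "isCont (\<lambda>z. fst z + w1 (U z)) (p, H p)"
      using contU by (intro continuous_intros) auto
    then obtain e2 where e2: "e2 > 0"
      "\<And>z. dist z (p, H p) < e2 \<Longrightarrow> dist (fst z + w1 (U z)) (fst (p, H p) + w1 (U (p, H p))) < \<epsilon>"
      unfolding continuous_at_eps_delta using \<epsilon> by blast
    obtain e3 where e3: "e3 > 0" "ball (p, H p) e3 \<subseteq> N" using N openE by blast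
    show thesis
    proof (rule that[of "min e1 (min e2 e3)"])
      show "norm (U' z - U' (p, H p)) \<le> \<eta>" if "z \<in> ball (p, H p) (min e1 (min e2 e3))" for z
        using e1(2)[of z] that by (simp add: dist_norm norm_minus_commute)
      show "fst z + w1 (U z) \<in> ball p \<epsilon>" if "z \<in> ball (p, H p) (min e1 (min e2 e3))" for z
        using e2(2)[of z] that by (simp add: Up dist_commute)
    qed (use e1 e2 e3 in auto)
  qed

  obtain r1 where r1: "r1 > 0" "ball p r1 \<subseteq> \<Omega>" "ball p r1 \<subseteq> N0"
    and r1H: "\<And>v. v \<in> ball p r1 \<Longrightarrow> norm (H' v - A) \<le> \<eta>"
  proof -
    have "isCont H' p" using cont \<Omega> continuous_on_eq_continuous_at by blast
    then obtain e1 where e1: "e1 > 0" "\<And>z. dist z p < e1 \<Longrightarrow> dist (H' z) (H' p) < \<eta>"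
      unfolding continuous_at_eps_delta using \<eta>(1) by blast
    obtain e2 where e2: "e2 > 0" "ball p e2 \<subseteq> \<Omega>" using \<Omega> openE by blast
    obtain e3 where e3: "e3 > 0" "ball p e3 \<subseteq> N0" using N openE by blast
    show thesis
    proof (rule that[of "min e1 (min e2 e3)"])
      show "norm (H' v - A) \<le> \<eta>" if "v \<in> ball p (min e1 (min e2 e3))" for v
        using e1(2)[of v] that by (simp add: dist_norm norm_minus_commute A_def)
    qed (use e1 e2 e3 in auto)
  qed
  have H_incr: "norm (H x' - H x - A (x' - x)) \<le> \<eta> * norm (x' - x)"
    if "x \<in> ball p r1" "x' \<in> ball p r1" for x x'
  proof -
    have "norm ((H x' - A x') - (H x - A x)) \<le> \<eta> * norm (x' - x)"
    proof (rule differentiable_bound[OF convex_ball _ _ that(2,1)])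
      fix v assume v: "v \<in> ball p r1"
      show "((\<lambda>y. H y - A y) has_derivative blinfun_apply (H' v - A)) (at v within ball p r1)"
        using has_derivative_at_withinI[OF der] v r1(2)
        by (auto intro!: derivative_eq_intros bounded_linear_imp_has_derivative blinfun.bounded_linear_right
            simp: blinfun.diff_left fun_eq_iff)
      show "onorm (blinfun_apply (H' v - A)) \<le> \<eta>"
        using r1H[OF v] by (simp add: norm_blinfun.rep_eq)
    qed
    then show ?thesis by (simp add: blinfun.diff_right algebra_simps)
  qed
  have H_lip: "norm (H x' - H x) \<le> (nA + 1) * norm (x' - x)"
    if "x \<in> ball p r1" "x' \<in> ball p r1" for x x'
  proof -
    have "norm (H x' - H x) \<le> norm (A (x' - x)) + norm (H x' - H x - A (x' - x))"
      by (rule norm_triangle_sub)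
    also have "\<dots> \<le> nA * norm (x' - x) + 1 * norm (x' - x)"
      using A_le H_incr[OF that] mult_right_mono[OF \<eta>(2) norm_ge_zero[of "x' - x"]]
      by (intro add_mono) auto
    finally show ?thesis by (simp add: algebra_simps)
  qed

  \<comment> \<open>Bounds the distance of \<open>(a t, q t)\<close> from \<open>(p, H p)\<close> in
    units of \<open>r\<close>, for all \<open>t\<close> in \<open>{-1<..<2}\<close>; the first two
    terms come from \<open>a\<close>, the others from \<open>q\<close>.\<close>
  define C2 where "C2 = 4 + 4 * W + 20 * (nA + 1) + 4 * (nA * W)"
  have C2: "C2 \<ge> 0" using nA W by (simp add: C2_def)
  obtain r2 where r2: "r2 > 0" "(nA + 1) * r2 < \<eta>"
    by (rule ex_linear_small_bound[of "nA + 1" \<eta>]) (use nA \<eta> in auto)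
  obtain r3 where r3: "r3 > 0" "C2 * r3 < \<delta>"
    by (rule ex_linear_small_bound[OF C2 \<delta>(1)])
  \<comment> \<open>The bound 1 gives \<open>n \<le> 2\<close>, hence weights
    \<open>\<mu> t \<le> 1\<close> on \<open>{0..1}\<close>.\<close>
  define r where "r = min 1 (min r1 (min r2 r3))"
  have r: "r > 0" "r \<le> 1" "r \<le> r1" "r \<le> r2" "r \<le> r3" using r1 r2 r3 by (auto simp: r_def)
  have r\<eta>: "(nA + 1) * r \<le> \<eta>" using mult_left_mono[OF r(4), of "nA + 1"] nA r2(2) by linarith
  have r\<delta>: "C2 * r < \<delta>" using mult_left_mono[OF r(5) C2] r3 by simp

  have "\<exists>c c'. c 0 = x \<and> c 1 = x' \<and> continuous_on {-1<..<2} c' \<and>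
      (\<forall>t\<in>{-1<..<2}. (c has_vector_derivative c' t) (at t) \<and> c t \<in> ball p \<epsilon>) \<and>
      (\<forall>t\<in>{0..1}. H (c t) \<in> D \<and> norm (c' t - (x' - x)) \<le> \<epsilon> * norm (x' - x))"
    if x: "x \<in> ball p r" "x' \<in> ball p r" "H x \<in> D" "H x' \<in> D" for x x'
  proof -
    have xr1: "x \<in> ball p r1" "x' \<in> ball p r1" "p \<in> ball p r1" using x r r1 by auto
    have xp: "norm (x - p) \<le> r" "norm (x' - p) \<le> r"
      using x by (auto simp: dist_norm norm_minus_commute)
    define e where "e = x' - x"
    define n where "n = norm e"
    define y where "y = H x"
    define y' where "y' = H x'"
    have n: "0 \<le> n" "n \<le> 2 * r"
      using norm_triangle_ineq4[of "x' - p" "x - p"] xp by (auto simp: n_def e_def)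
    have yp: "norm (y - H p) \<le> (nA + 1) * r" "norm (y' - H p) \<le> (nA + 1) * r"
      using H_lip[OF xr1(3) xr1(1)] H_lip[OF xr1(3) xr1(2)] xp nA unfolding y_def y'_def
      by (meson add_nonneg_nonneg mult_left_mono order_trans zero_le_one)+
    define \<mu> where "\<mu> t = \<kappa> * n * (t * (1 - t))" for t :: real
    define \<mu>' where "\<mu>' t = \<kappa> * n * (1 - 2 * t)" for t :: real
    define b where "b t = (1 - t) *\<^sub>R y + t *\<^sub>R y'" for t :: real
    define a where "a t = x + t *\<^sub>R e + \<mu> t *\<^sub>R w0" for t
    define a' where "a' t = e + \<mu>' t *\<^sub>R w0" for t
    \<comment> \<open>On \<open>{0..1}\<close> the target is a convex combination of the chord point
      \<open>b t\<close> and the relative interior point \<open>d0\<close>; \<open>a\<close> carries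
      the matching push \<open>\<mu> t *\<^sub>R w0\<close> in the source.\<close>
    define q where "q t = b t + \<mu> t *\<^sub>R (d0 - b t)" for t
    define q' where "q' t = (y' - y) + \<mu>' t *\<^sub>R (d0 - b t) - \<mu> t *\<^sub>R (y' - y)" for t
    define u where "u t = U (a t, q t)" for t
    define u' where "u' t = U' (a t, q t) (a' t, q' t)" for t
    define c where "c t = a t + w1 (u t)" for t
    define c' where "c' t = a' t + w1 (u' t)" for t
    have d\<mu>: "(\<mu> has_vector_derivative \<mu>' t) (at t)" for t
      unfolding \<mu>_def \<mu>'_def has_real_derivative_iff_has_vector_derivative[symmetric]
      by (auto intro!: derivative_eq_intros simp: algebra_simps)
    have db: "(b has_vector_derivative (y' - y)) (at t)" for t
      unfolding b_def by (auto intro!: derivative_eq_intros simp: algebra_simps)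
    have da: "(a has_vector_derivative a' t) (at t)" for t
      unfolding a_def a'_def using d\<mu>[of t, THEN has_real_derivative_iff_has_vector_derivative[THEN iffD2]]
      by (auto intro!: derivative_eq_intros)
    have dq: "(q has_vector_derivative q' t) (at t)" for t
      unfolding q_def q'_def using d\<mu>[of t, THEN has_real_derivative_iff_has_vector_derivative[THEN iffD2]] db[of t]
      by (auto intro!: derivative_eq_intros simp: algebra_simps)

    have near: "(a t, q t) \<in> ball (p, H p) \<delta>" if t: "t \<in> {-1<..<2}" for t
    proof -
      have tt: "\<bar>t * (1 - t)\<bar> \<le> 2"
        unfolding abs_mult using t mult_mono[of "\<bar>t\<bar>" 2 "\<bar>1 - t\<bar>" 1] mult_mono[of "\<bar>t\<bar>" 1 "\<bar>1 - t\<bar>" 2]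
        by (cases "t \<ge> 0"; cases "t \<ge> 1") auto
      have \<mu>4: "\<bar>\<mu> t\<bar> \<le> 4 * r"
      proof -
        have "\<bar>\<mu> t\<bar> = \<kappa> * n * \<bar>t * (1 - t)\<bar>" using \<kappa> n by (simp add: \<mu>_def abs_mult)
        also have "\<dots> \<le> 1 * (2 * r) * 2" using tt \<kappa> n r(1) by (intro mult_mono) auto
        finally show ?thesis by simp
      qed
      have 2: "\<bar>1 - t\<bar> \<le> 2" "\<bar>t\<bar> \<le> 2" using t by auto
      have "a t - p = (1 - t) *\<^sub>R (x - p) + t *\<^sub>R (x' - p) + \<mu> t *\<^sub>R w0"
        by (simp add: a_def e_def algebra_simps)
      also have "norm \<dots> \<le> \<bar>1 - t\<bar> * norm (x - p) + \<bar>t\<bar> * norm (x' - p) + \<bar>\<mu> t\<bar> * W"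
        unfolding W_def by (intro norm_triangle_le add_mono) auto
      also have "\<dots> \<le> 2 * r + 2 * r + (4 * r) * W"
        using 2 \<mu>4 xp W r by (intro add_mono mult_mono) auto
      finally have at: "norm (a t - p) \<le> (4 + 4 * W) * r" by (simp add: algebra_simps)
      have "b t - H p = (1 - t) *\<^sub>R (y - H p) + t *\<^sub>R (y' - H p)"
        by (simp add: b_def algebra_simps)
      also have "norm \<dots> \<le> \<bar>1 - t\<bar> * norm (y - H p) + \<bar>t\<bar> * norm (y' - H p)"
        by (intro norm_triangle_le add_mono) auto
      also have "\<dots> \<le> 2 * ((nA + 1) * r) + 2 * ((nA + 1) * r)"
        using 2 yp by (intro add_mono mult_mono) auto
      finally have bt: "norm (b t - H p) \<le> 4 * ((nA + 1) * r)" by linarith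
      have "q t - H p = (1 - \<mu> t) *\<^sub>R (b t - H p) + \<mu> t *\<^sub>R A w0"
        by (simp add: q_def d0_def algebra_simps)
      also have "norm \<dots> \<le> \<bar>1 - \<mu> t\<bar> * norm (b t - H p) + \<bar>\<mu> t\<bar> * norm (A w0)"
        by (intro norm_triangle_le add_mono) auto
      also have "\<dots> \<le> 5 * (4 * ((nA + 1) * r)) + (4 * r) * (nA * W)"
        using \<mu>4 bt A_le[of w0] r unfolding W_def by (intro add_mono mult_mono) auto
      finally have qt: "norm (q t - H p) \<le> (20 * (nA + 1) + 4 * (nA * W)) * r"
        by (simp add: algebra_simps)
      have "dist (p, H p) (a t, q t) = norm (a t - p, q t - H p)"
        by (simp add: dist_norm norm_minus_commute flip: diff_Pair)
      also have "\<dots> \<le> norm (a t - p) + norm (q t - H p)" by (rule norm_Pair_le)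
      also have "\<dots> \<le> C2 * r" using at qt by (simp add: C2_def algebra_simps)
      also have "\<dots> < \<delta>" by (rule r\<delta>)
      finally show ?thesis by simp
    qed
    then have inN: "(a t, q t) \<in> N" if "t \<in> {-1<..<2}" for t using \<delta>(2) that by blast
    have du: "(u has_vector_derivative u' t) (at t)" if t: "t \<in> {-1<..<2}" for t
    proof -
      have "((\<lambda>t. (a t, q t)) has_vector_derivative (a' t, q' t)) (at t)"
        by (intro has_vector_derivative_Pair da dq)
      then have "((\<lambda>t. (a t, q t)) has_derivative (\<lambda>h. h *\<^sub>R (a' t, q' t))) (at t)"
        by (simp add: has_vector_derivative_def)
      from has_derivative_compose[OF this derU[OF inN[OF t]]] show ?thesis
        unfolding u_def[abs_def] u'_def has_vector_derivative_def by (simp only: blinfun.scaleR_right)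
    qed
    have dc: "(c has_vector_derivative c' t) (at t)" if t: "t \<in> {-1<..<2}" for t
      unfolding c_def[abs_def] c'_def
      by (intro has_vector_derivative_add da bounded_linear.has_vector_derivative[OF blinfun.bounded_linear_right] du t)
    have cont_\<mu>': "continuous_on T \<mu>'" "continuous_on T \<mu>" "continuous_on T b" for T
      unfolding \<mu>'_def[abs_def] \<mu>_def[abs_def] b_def[abs_def] by (auto intro!: continuous_intros)
    have cont_a: "continuous_on T a" "continuous_on T q" "continuous_on T a'" "continuous_on T q'" for T
      unfolding a_def[abs_def] q_def[abs_def] a'_def[abs_def] q'_def[abs_def]
      using cont_\<mu>' by (auto intro!: continuous_intros)
    have "continuous_on {-1<..<2} (\<lambda>t. U' (a t, q t))"
      by (rule continuous_on_compose2[OF contU']) (use inN cont_a in \<open>auto intro!: continuous_intros\<close>)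
    then have cc': "continuous_on {-1<..<2} c'"
      unfolding c'_def[abs_def] u'_def using cont_a by (intro continuous_intros)

    have \<mu>01: "0 \<le> \<mu> t" "\<mu> t \<le> \<kappa> * n / 4" "\<bar>\<mu>' t\<bar> \<le> \<kappa> * n" if t: "t \<in> {0..1}" for t
    proof -
      show "0 \<le> \<mu> t" using t \<kappa> n by (simp add: \<mu>_def)
      have "0 \<le> (t - 1/2)\<^sup>2" by simp
      then have "t * (1 - t) \<le> 1/4" by (simp add: power2_eq_square algebra_simps)
      then have "(\<kappa> * n) * (t * (1 - t)) \<le> (\<kappa> * n) * (1/4)" using \<kappa> n by (intro mult_left_mono) auto
      then show "\<mu> t \<le> \<kappa> * n / 4" by (simp add: \<mu>_def)
      have "\<bar>\<mu>' t\<bar> = \<kappa> * n * \<bar>1 - 2 * t\<bar>" using \<kappa> n by (simp add: \<mu>'_def abs_mult)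
      also have "\<dots> \<le> \<kappa> * n * 1" using t \<kappa> n by (intro mult_left_mono) auto
      finally show "\<bar>\<mu>' t\<bar> \<le> \<kappa> * n" by simp
    qed
    have \<kappa>n: "\<kappa> * n \<le> n" using \<kappa> n by (simp add: mult_left_le_one_le)
    have \<eta>n: "0 \<le> \<eta> * n" using \<eta> n by simp
    have y\<eta>: "norm (y - H p) \<le> \<eta>" "norm (y' - H p) \<le> \<eta>" using yp r\<eta> by linarith+
    have yy: "norm (y' - y) \<le> 2 * \<eta>"
      using norm_triangle_ineq4[of "y' - H p" "y - H p"] y\<eta> by simp
    have u'_le: "norm (u' t) \<le> \<eta> * C1 * n" if t: "t \<in> {0..1}" for t
    proof -
      have "b t - H p = (1 - t) *\<^sub>R (y - H p) + t *\<^sub>R (y' - H p)"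
        by (simp add: b_def algebra_simps)
      also have "norm \<dots> \<le> (1 - t) * norm (y - H p) + t * norm (y' - H p)"
        using t by (intro norm_triangle_le add_mono) auto
      also have "\<dots> \<le> (1 - t) * \<eta> + t * \<eta>"
        using t y\<eta> by (intro add_mono mult_left_mono) auto
      finally have bt: "norm (b t - H p) \<le> \<eta>" by (simp add: algebra_simps)
      \<comment> \<open>The two pushes cancel to first order, because
        \<open>d0 = H p + A w0\<close>; every remaining term carries a factor
        \<open>\<eta> * n\<close>.\<close>
      have "q' t - A (a' t) = (y' - y - A e) + \<mu>' t *\<^sub>R (H p - b t) - \<mu> t *\<^sub>R (y' - y)"
        by (simp add: q'_def a'_def d0_def blinfun.add_right blinfun.scaleR_right algebra_simps)
      also have "norm \<dots> \<le> norm (y' - y - A e) + \<bar>\<mu>' t\<bar> * norm (b t - H p) + \<mu> t * norm (y' - y)"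
        using \<mu>01(1)[OF t]
          norm_triangle_ineq4[of "(y' - y - A e) + \<mu>' t *\<^sub>R (H p - b t)" "\<mu> t *\<^sub>R (y' - y)"]
          norm_triangle_ineq[of "y' - y - A e" "\<mu>' t *\<^sub>R (H p - b t)"]
        by (simp add: norm_minus_commute[of "b t"])
      also have "\<dots> \<le> \<eta> * n + n * \<eta> + (n / 4) * (2 * \<eta>)"
        using H_incr[OF xr1(1,2)] \<mu>01[OF t] bt yy \<kappa>n n unfolding y_def y'_def e_def n_def
        by (intro add_mono mult_mono) auto
      also have "\<dots> \<le> 3 * (\<eta> * n)" using \<eta>n by (simp add: algebra_simps)
      finally have qA: "norm (q' t - A (a' t)) \<le> 3 * (\<eta> * n)" .
      have "norm (a' t) \<le> norm e + \<bar>\<mu>' t\<bar> * norm w0"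
        unfolding a'_def by (intro norm_triangle_le) simp
      also have "\<dots> \<le> n + n * W"
        using \<mu>01[OF t] \<kappa>n n W unfolding n_def W_def by (intro add_mono mult_mono) auto
      finally have a't: "norm (a' t) \<le> (1 + W) * n" by (simp add: algebra_simps)
      have "norm (q' t) \<le> norm (A (a' t)) + norm (q' t - A (a' t))" by (rule norm_triangle_sub)
      also have "\<dots> \<le> nA * ((1 + W) * n) + 3 * (1 * n)"
      proof (intro add_mono)
        show "norm (A (a' t)) \<le> nA * ((1 + W) * n)"
          using A_le[of "a' t"] mult_left_mono[OF a't nA] by linarith
        show "norm (q' t - A (a' t)) \<le> 3 * (1 * n)"
          using qA mult_right_mono[OF \<eta>(2) n(1)] by linarith
      qed
      finally have q't: "norm (q' t) \<le> nA * ((1 + W) * n) + 3 * n" by simp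
      have aq: "norm (a' t, q' t) \<le> (1 + W) * n + (nA * ((1 + W) * n) + 3 * n)"
        using norm_Pair_le[of "a' t" "q' t"] a't q't by linarith
      have tt: "t \<in> {-1<..<2}" using t by auto
      \<comment> \<open>At the base point the derivative of \<open>U\<close> sends
        \<open>(\<alpha>, \<beta>)\<close> to \<open>\<beta> - A \<alpha>\<close>, so the velocity
        is the defect just estimated plus the variation of \<open>U'\<close>.\<close>
      have "u' t = (q' t - A (a' t)) + (U' (a t, q t) - U' (p, H p)) (a' t, q' t)"
        by (simp add: u'_def blinfun.diff_left U'p)
      also have "norm \<dots> \<le> norm (q' t - A (a' t)) + norm (U' (a t, q t) - U' (p, H p)) * norm (a' t, q' t)"
        by (intro norm_triangle_le add_mono norm_blinfun order_refl)
      also have "\<dots> \<le> 3 * (\<eta> * n) + \<eta> * ((1 + W) * n + (nA * ((1 + W) * n) + 3 * n))"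
        using qA \<delta>U'[OF near[OF tt]] aq \<eta> by (intro add_mono mult_mono) auto
      also have "\<dots> = \<eta> * C1 * n" by (simp add: C1_def algebra_simps)
      finally show ?thesis .
    qed
    have u01: "u 0 = 0" "u 1 = 0"
      using U0 xr1 r1(3) by (auto simp: u_def a_def q_def \<mu>_def b_def e_def y_def y'_def subset_iff)
    define B where "B = \<eta> * C1 * n"
    have B: "B \<ge> 0" using \<eta> C1 n by (simp add: B_def)
    have u_lip: "norm (u t - u s) \<le> B * norm (t - s)" if "s \<in> {0..1}" "t \<in> {0..1}" for s t
    proof (rule differentiable_bound[of "{0..1}" _ "\<lambda>t h. h *\<^sub>R u' t"])
      fix v :: real assume v: "v \<in> {0..1}"
      then show "(u has_derivative (\<lambda>h. h *\<^sub>R u' v)) (at v within {0..1})"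
        using du[of v] by (auto simp: has_vector_derivative_def intro: has_derivative_at_withinI)
      show "onorm (\<lambda>h. h *\<^sub>R u' v) \<le> B"
        using u'_le[OF v] onorm_scaleR_left[of "\<lambda>h::real. h" "u' v"]
        by (simp add: B_def onorm_id[unfolded id_def] bounded_linear_ident)
    qed (use that in auto)
    \<comment> \<open>The Lipschitz bound is used from the nearer end point, where \<open>u\<close>
      vanishes; the farther factor is at least 1/2, which costs the 2.\<close>
    have u_le: "norm (u t) \<le> 2 * B * (t * (1 - t))" if t: "t \<in> {0..1}" for t
    proof (cases "t \<le> 1/2")
      case True
      have "norm (u t) \<le> B * t" using u_lip[of 0 t] t u01 by simp
      also have "\<dots> \<le> B * (2 * (t * (1 - t)))"
        using True t B mult_left_mono[of 1 "2 * (1 - t)" t] by (intro mult_left_mono) (auto simp: mult_ac)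
      finally show ?thesis by (simp add: mult_ac)
    next
      case False
      have "norm (u t) \<le> B * (1 - t)" using u_lip[of 1 t] t u01 by simp
      also have "\<dots> \<le> B * (2 * (t * (1 - t)))"
        using False t B mult_right_mono[of 1 "2 * t" "1 - t"] by (intro mult_left_mono) (auto simp: mult_ac)
      finally show ?thesis by (simp add: mult_ac)
    qed
    have HcD: "H (c t) \<in> D" if t: "t \<in> {0..1}" for t
    proof -
      have "t \<in> {-1<..<2}" using t by auto
      then have Hc: "H (c t) = q t + \<sigma> (u t)" unfolding c_def u_def by (intro HU inN)
      have bD: "b t \<in> D" unfolding b_def using t x(3,4) D(1)
        by (auto simp: convex_alt y_def y'_def)
      have "\<kappa> * (2 * B * (t * (1 - t))) = 2 * \<eta> * C1 * \<mu> t" by (simp add: B_def \<mu>_def mult_ac)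
      then have \<kappa>u: "\<kappa> * norm (u t) \<le> 2 * \<eta> * C1 * \<mu> t"
        using mult_left_mono[OF u_le[OF t], of \<kappa>] \<kappa>(1) by linarith
      show ?thesis
      \<comment> \<open>The weight vanishes at the end points and for \<open>x = x'\<close>; then
        the correction vanishes too and the target is the chord point.\<close>
      proof (cases "\<mu> t = 0")
        case True
        then have "u t = 0" using \<kappa>u \<kappa> by (simp add: mult_le_0_iff)
        then show ?thesis using Hc True bD by (simp add: q_def)
      next
        case False
        then have l0: "\<mu> t > 0" using \<mu>01(1)[OF t] by simp
        have l1: "\<mu> t \<le> 1" using \<mu>01(2)[OF t] \<kappa>n n r(2) by linarith
        have "\<kappa> * norm (\<sigma> (u t)) \<le> norm \<sigma> * (\<kappa> * norm (u t))"
          using mult_left_mono[OF norm_blinfun[of \<sigma> "u t"], of \<kappa>] \<kappa> by (simp add: mult_ac)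
        also have "\<dots> \<le> norm \<sigma> * (2 * \<eta> * C1 * \<mu> t)" by (intro mult_left_mono \<kappa>u) simp
        also have "\<dots> = (norm \<sigma> * 2 * C1 * \<eta>) * \<mu> t" by (simp add: mult_ac)
        also have "\<dots> \<le> (\<rho> * \<kappa>) * \<mu> t" using l0 by (intro mult_right_mono \<eta>\<sigma>) simp
        finally have "\<kappa> * norm (\<sigma> (u t)) \<le> \<kappa> * (\<rho> * \<mu> t)" by (simp add: mult_ac)
        then have "norm (\<sigma> (u t)) \<le> \<rho> * \<mu> t" using \<kappa>(1) by simp
        then have "norm (\<sigma> (u t /\<^sub>R \<mu> t)) \<le> \<rho>"
          using l0 by (simp add: blinfun.scaleR_right field_simps)
        then have "d0 + \<sigma> (u t /\<^sub>R \<mu> t) \<in> D" using inD unfolding d0_def \<sigma> by blast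
        \<comment> \<open>The correction is absorbed into the interior point: divided by the weight
          \<open>\<mu> t\<close>, its image under \<open>\<sigma>\<close> has norm at most
          \<open>\<rho>\<close>.\<close>
        then have "(1 - \<mu> t) *\<^sub>R b t + \<mu> t *\<^sub>R (d0 + \<sigma> (u t /\<^sub>R \<mu> t)) \<in> D"
          using D(1) bD l0 l1 by (auto simp: convex_alt)
        moreover have "(1 - \<mu> t) *\<^sub>R b t + \<mu> t *\<^sub>R (d0 + \<sigma> (u t /\<^sub>R \<mu> t)) = q t + \<sigma> (u t)"
          using l0 by (simp add: q_def blinfun.scaleR_right algebra_simps)
        ultimately show ?thesis using Hc by simp
      qed
    qed
    have c'_le: "norm (c' t - (x' - x)) \<le> \<epsilon> * norm (x' - x)" if t: "t \<in> {0..1}" for t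
    proof -
      have "c' t - (x' - x) = \<mu>' t *\<^sub>R w0 + w1 (u' t)" by (simp add: c'_def a'_def e_def)
      also have "norm \<dots> \<le> \<bar>\<mu>' t\<bar> * W + norm w1 * norm (u' t)"
        unfolding W_def by (intro norm_triangle_le add_mono norm_blinfun) auto
      also have "\<dots> \<le> (\<kappa> * n) * W + norm w1 * (\<eta> * C1 * n)"
        using \<mu>01(3)[OF t] u'_le[OF t] W by (intro add_mono mult_right_mono mult_left_mono) auto
      also have "\<dots> = (W * \<kappa> + norm w1 * C1 * \<eta>) * n" by (simp add: algebra_simps)
      also have "\<dots> \<le> \<epsilon> * n" using \<kappa>W \<eta>w n by (intro mult_right_mono) auto
      finally show ?thesis by (simp add: n_def e_def)
    qed
    have "c 0 = x" "c 1 = x'" using u01 by (auto simp: c_def a_def \<mu>_def e_def)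
    moreover have "c t \<in> ball p \<epsilon>" if "t \<in> {-1<..<2}" for t
      using \<delta>E[OF near[OF that]] by (simp add: c_def u_def)
    ultimately show ?thesis using cc' dc HcD c'_le by blast
  qed
  then show ?thesis using r(1) by blast
qed

text \<open>Both functions agree along a curve in \<open>M\<close> with velocity \<open>v\<close>,
  so the chain rule gives the same value. This relates the arbitrary extensions in
  \<open>mfld_diff_range\<close> to the single extension used in the proof.\<close>

lemma tangent_differential_eq:
  fixes H G :: "'a::euclidean_space \<Rightarrow> 'b::euclidean_space"
  assumes v: "v \<in> tangent_space M x" and T: "open T" "x \<in> T"
    and eq: "\<And>z. z \<in> M \<Longrightarrow> z \<in> T \<Longrightarrow> G z = H z"
    and G: "(G has_derivative G') (at x)" and H: "(H has_derivative H') (at x)"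
  shows "G' v = H' v"
proof -
  obtain \<gamma> e where \<gamma>: "e > 0" "\<gamma> 0 = x" "\<And>t. t \<in> {-e<..<e} \<Longrightarrow> \<gamma> t \<in> M"
    "(\<gamma> has_vector_derivative v) (at 0)"
    using v unfolding tangent_space_def by blast
  have d: "(\<gamma> has_derivative (\<lambda>h. h *\<^sub>R v)) (at 0)" using \<gamma>(4) by (simp add: has_vector_derivative_def)
  have dG: "((\<lambda>t. G (\<gamma> t)) has_derivative (\<lambda>h. G' (h *\<^sub>R v))) (at 0)"
    using has_derivative_compose[OF d] G \<gamma>(2) by simp
  have dH: "((\<lambda>t. H (\<gamma> t)) has_derivative (\<lambda>h. H' (h *\<^sub>R v))) (at 0)"
    using has_derivative_compose[OF d] H \<gamma>(2) by simp
  have "(\<gamma> \<longlongrightarrow> \<gamma> 0) (at 0)" using has_derivative_continuous[OF d] isCont_def by blast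
  then have "\<forall>\<^sub>F t in at 0. \<gamma> t \<in> T" using topological_tendstoD T \<gamma>(2) by blast
  moreover have "\<forall>\<^sub>F t in at 0. t \<in> {-e<..<e}"
    using \<gamma>(1) by (intro eventually_at_in_open') auto
  ultimately have "\<forall>\<^sub>F t in at 0. H (\<gamma> t) = G (\<gamma> t)"
    by eventually_elim (use eq \<gamma>(3) in auto)
  then have "((\<lambda>t. G (\<gamma> t)) has_derivative (\<lambda>h. H' (h *\<^sub>R v))) (at 0)"
    using has_derivative_transform_eventually[OF dH] eq[of x] \<gamma>(1-3) T(2) by auto
  from has_derivative_unique[OF dG this] have "G' (1 *\<^sub>R v) = H' (1 *\<^sub>R v)" by metis
  then show ?thesis by simp
qed

section \<open>Transfer to the submanifold and comparison of velocities\<close>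

theorem theorem4p7:
  fixes M C :: "'a::euclidean_space set" and xbar :: 'a
    and V :: "'a set" and F :: "'a \<Rightarrow> 'b::euclidean_space" and D :: "'b set"
  assumes "C3_embedded_submanifold M"
    and "C \<subseteq> M" and "xbar \<in> C"
    and "amenable_via M C xbar V F D"
  shows "smoothly_approx_convex M C xbar"
proof -
  have xM: "xbar \<in> M" using assms by blast
  obtain r K P P' where "C11_retraction M xbar r K P P'"
    using C3_embedded_submanifold_retraction[OF assms(1) xM] .
  then interpret C11_retraction M xbar r K P P' .
  have V: "openin (top_of_set M) V" "xbar \<in> V" and FC1: "mfld_C1 M V F" and D: "convex D"
    and CV: "C \<inter> V = {x \<in> V. F x \<in> D}"
    and cq: "\<And>y. y \<in> normal_cone D (F xbar) \<Longrightarrow> (\<forall>w\<in>mfld_diff_range M V F xbar. inner y w = 0) \<Longrightarrow> y = 0"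
    using assms(4) unfolding amenable_via_def by auto
  obtain V' where V': "open V'" "V = M \<inter> V'" using V(1) by (auto simp: openin_open)
  have "\<exists>U G. open U \<and> xbar \<in> U \<and> C1_on U G \<and> (\<forall>y\<in>V \<inter> U. G y = F y)"
    using FC1 V(2) unfolding mfld_C1_def by (rule bspec)
  then obtain U G where U: "open U" "xbar \<in> U" "C1_on U G" and GF: "\<And>y. y \<in> V \<Longrightarrow> y \<in> U \<Longrightarrow> G y = F y"
    by auto
  obtain G' :: "'a \<Rightarrow> 'a \<Rightarrow>\<^sub>L 'b" where G': "\<And>x. x \<in> U \<Longrightarrow> (G has_derivative blinfun_apply (G' x)) (at x)"
    "continuous_on U G'"
    using U(3) unfolding C1_on_def by blast
  have contP: "continuous_on (ball xbar r) P"
    using deriv has_derivative_continuous by (intro continuous_at_imp_continuous_on) blast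
  \<comment> \<open>Exactly the points of the ball that the retraction sends into both the domain of
    \<open>G\<close> and \<open>V\<close>.\<close>
  define \<Omega> where "\<Omega> = ball xbar r \<inter> P -` (U \<inter> V')"
  have Pxbar: "P xbar = xbar" using fixed xM r by simp
  have \<Omega>: "open \<Omega>" "xbar \<in> \<Omega>"
    unfolding \<Omega>_def using contP U(1) V'(1) continuous_open_preimage[of "ball xbar r" P "U \<inter> V'"]
    using Pxbar U(2) V(2) V'(2) r by auto
  have \<Omega>D: "y \<in> ball xbar r" "P y \<in> U" "P y \<in> V" if "y \<in> \<Omega>" for y
    using that into V'(2) by (auto simp: \<Omega>_def)
  \<comment> \<open>Since \<open>P\<close> is built in, \<open>P y \<in> C\<close> is equivalent to
    \<open>H y \<in> D\<close> on \<open>\<Omega>\<close>: a curve may be constructed off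
    \<open>M\<close> and retracted afterwards.\<close>
  define H where "H y = G (P y)" for y
  define H' where "H' y = G' (P y) o\<^sub>L P' y" for y
  have derH: "(H has_derivative blinfun_apply (H' y)) (at y)" if "y \<in> \<Omega>" for y
    using has_derivative_compose[OF deriv G'(1)] \<Omega>D[OF that]
    by (simp add: H_def[abs_def] H'_def blinfun_compose.rep_eq o_def)
  have contH': "continuous_on \<Omega> H'"
  proof -
    have "continuous_on \<Omega> (\<lambda>y. G' (P y))"
      by (rule continuous_on_compose2[OF G'(2) continuous_on_subset[OF contP]]) (use \<Omega>D in auto)
    moreover have "continuous_on \<Omega> P'"
      by (rule continuous_on_subset[OF continuous_deriv]) (use \<Omega>D in auto)
    ultimately show ?thesis unfolding H'_def[abs_def]
      by (rule bounded_bilinear.continuous_on[OF bounded_bilinear_blinfun_compose])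
  qed
  have H_iff: "P y \<in> C \<longleftrightarrow> H y \<in> D" if "y \<in> \<Omega>" for y
    using CV GF[OF \<Omega>D(3,2)] \<Omega>D(3)[OF that] that by (auto simp: H_def)
  have HD: "H y \<in> D" if "y \<in> \<Omega>" "y \<in> C" for y
    using H_iff[OF that(1)] fixed[OF \<Omega>D(1)] that assms(2) by auto
  have HF: "H xbar = F xbar" using GF V(2) U(2) by (simp add: H_def Pxbar)
  \<comment> \<open>Orthogonality to the whole range of \<open>H' xbar\<close> implies orthogonality
    to the range of the differential, as every admissible extension agrees with \<open>H'\<close> on
    tangent vectors.\<close>
  have cqH: "y = 0" if y: "y \<in> normal_cone D (H xbar)" "\<And>v. inner y (H' xbar v) = 0" for y
  proof (rule cq)
    show "y \<in> normal_cone D (F xbar)" using y(1) HF by simp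
    show "\<forall>w\<in>mfld_diff_range M V F xbar. inner y w = 0"
    proof
      fix w assume "w \<in> mfld_diff_range M V F xbar"
      then obtain v U2 G2 G2' where v: "v \<in> tangent_space M xbar" "open U2" "xbar \<in> U2"
        "\<forall>z\<in>V \<inter> U2. G2 z = F z" "(G2 has_derivative G2') (at xbar)" "w = G2' v"
        unfolding mfld_diff_range_def by blast
      have "G2' v = H' xbar v"
      proof (rule tangent_differential_eq[OF v(1) _ _ _ v(5) derH[OF \<Omega>(2)]])
        show "open (\<Omega> \<inter> U2)" "xbar \<in> \<Omega> \<inter> U2" using \<Omega> v(2,3) by auto
        fix z assume z: "z \<in> M" "z \<in> \<Omega> \<inter> U2"
        then have "P z = z" using fixed \<Omega>D(1) by blast
        then show "G2 z = H z" using z \<Omega>D[of z] v(4) GF by (simp add: H_def)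
      qed
      then show "inner y w = 0" using y(2) v(6) by simp
    qed
  qed
  obtain \<delta> where \<delta>: "\<delta> > 0" "\<delta> \<le> r"
    and dist: "\<And>x x'. \<lbrakk>x \<in> M; x \<in> ball xbar \<delta>; x' \<in> M; x' \<in> ball xbar \<delta>\<rbrakk> \<Longrightarrow>
        norm (x' - x) \<le> riem_dist M x x' \<and> riem_dist M x x' \<le> 2 * norm (x' - x)"
    and avg: "\<And>x x' g t. \<lbrakk>x \<in> M; x \<in> ball xbar \<delta>; x' \<in> M; x' \<in> ball xbar \<delta>; x \<noteq> x'; averaging_map M x x' g; t \<in> {0..1}\<rbrakk> \<Longrightarrow>
       \<exists>d. (g has_vector_derivative d) (at t within {0..1}) \<and>
           norm (d - (x' - x)) \<le> 8 * K * (riem_dist M x x')\<^sup>2"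
    using averaging_map_derivative by metis
  obtain r\<Omega> where r\<Omega>: "r\<Omega> > 0" "ball xbar r\<Omega> \<subseteq> \<Omega>" using \<Omega> openE by blast
  define BP where "BP = norm (P' xbar) + K * r"
  have BP: "BP \<ge> 0" using K r by (simp add: BP_def)
  have P'_le: "norm (P' y) \<le> BP" if y: "y \<in> ball xbar r" for y
  proof -
    have "norm (P' y - P' xbar) \<le> K * norm (y - xbar)" using lip y r by simp
    also have "\<dots> \<le> K * r" using y K by (intro mult_left_mono) (auto simp: dist_norm norm_minus_commute)
    finally show ?thesis using norm_triangle_sub[of "P' y" "P' xbar"] unfolding BP_def by linarith
  qed
  show ?thesis unfolding smoothly_approx_convex_def
  proof (intro allI impI)
    fix \<epsilon> :: real assume \<epsilon>: "\<epsilon> > 0"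
    \<comment> \<open>\<open>BP\<close> accounts for the velocity error of \<open>c\<close> carried
      through \<open>P'\<close>, and \<open>2 * K\<close> for the failure of \<open>P'\<close> to
      fix the chord.\<close>
    obtain \<epsilon>0 where \<epsilon>0: "\<epsilon>0 > 0" "(BP + 2 * K) * \<epsilon>0 < \<epsilon> / 2"
      by (rule ex_linear_small_bound[of "BP + 2 * K" "\<epsilon> / 2"]) (use BP K \<epsilon> in auto)
    define \<epsilon>1 where "\<epsilon>1 = min \<epsilon>0 r\<Omega>"
    have \<epsilon>1: "\<epsilon>1 > 0" "\<epsilon>1 \<le> \<epsilon>0" "\<epsilon>1 \<le> r\<Omega>" using \<epsilon>0 r\<Omega> by (auto simp: \<epsilon>1_def)
    have \<epsilon>1_le: "(BP + 2 * K) * \<epsilon>1 \<le> \<epsilon> / 2"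
      using mult_left_mono[OF \<epsilon>1(2), of "BP + 2 * K"] BP K \<epsilon>0(2) by linarith
    have ball\<Omega>: "ball xbar \<epsilon>1 \<subseteq> \<Omega>" using r\<Omega>(2) \<epsilon>1(3) by (meson subset_ball subset_trans)
    obtain r1 where r1: "r1 > 0"
      and curve: "\<And>x x'. \<lbrakk>x \<in> ball xbar r1; x' \<in> ball xbar r1; H x \<in> D; H x' \<in> D\<rbrakk> \<Longrightarrow>
        \<exists>c c'. c 0 = x \<and> c 1 = x' \<and> continuous_on {-1<..<2} c' \<and>
          (\<forall>t\<in>{-1<..<2}. (c has_vector_derivative c' t) (at t) \<and> c t \<in> ball xbar \<epsilon>1) \<and>
          (\<forall>t\<in>{0..1}. H (c t) \<in> D \<and> norm (c' t - (x' - x)) \<le> \<epsilon>1 * norm (x' - x))"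
      using curve_in_preimage_of_convex[OF \<Omega> derH contH' D HD[OF \<Omega>(2) assms(3)] cqH \<epsilon>1(1)] by metis
    \<comment> \<open>Points of the final ball satisfy \<open>L \<le> 4 * r2\<close>, so the
      deviation \<open>8 * K * L\<^sup>2\<close> of an averaging map is at most
      \<open>32 * K * r2 * L\<close>.\<close>
    obtain r2 where r2: "r2 > 0" "(32 * K) * r2 < \<epsilon> / 2"
      by (rule ex_linear_small_bound[of "32 * K" "\<epsilon> / 2"]) (use K \<epsilon> in auto)
    define r3 where "r3 = min (min \<delta> \<epsilon>1) (min r1 r2)"
    have r3: "r3 > 0" "r3 \<le> \<delta>" "r3 \<le> \<epsilon>1" "r3 \<le> r1" "r3 \<le> r2"
      using \<delta> \<epsilon>1 r1 r2 by (auto simp: r3_def)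
    show "\<exists>W. open W \<and> xbar \<in> W \<and>
        (\<forall>x\<in>C \<inter> W. \<forall>x'\<in>C \<inter> W. x \<noteq> x' \<longrightarrow>
           (\<exists>\<gamma>. smooth_curve_segment C \<gamma> \<and> \<gamma> 0 = x \<and> \<gamma> 1 = x' \<and>
              (\<forall>g. averaging_map M x x' g \<longrightarrow>
                 (\<forall>t\<in>{0..1}. \<exists>v w. (\<gamma> has_vector_derivative v) (at t within {0..1}) \<and>
                    (g has_vector_derivative w) (at t within {0..1}) \<and>
                    norm (v - w) \<le> \<epsilon> * riem_dist M x x'))))"
    proof (intro exI[of _ "ball xbar r3"] conjI ballI impI)
      fix x x' assume "x \<in> C \<inter> ball xbar r3" "x' \<in> C \<inter> ball xbar r3" and neq: "x \<noteq> x'"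
      then have xC: "x \<in> C" "x' \<in> C" and xb: "x \<in> ball xbar r3" "x' \<in> ball xbar r3" by auto
      have xM: "x \<in> M" "x' \<in> M" using xC assms(2) by auto
      have x\<delta>: "x \<in> ball xbar \<delta>" "x' \<in> ball xbar \<delta>" using xb r3 by auto
      have x\<epsilon>: "x \<in> ball xbar \<epsilon>1" "x' \<in> ball xbar \<epsilon>1" using xb r3 by auto
      have x1: "x \<in> ball xbar r1" "x' \<in> ball xbar r1" using xb r3 by auto
      have x\<Omega>: "x \<in> \<Omega>" "x' \<in> \<Omega>" using x\<epsilon> ball\<Omega> by auto
      have Px: "P x = x" "P x' = x'" using fixed \<Omega>D(1) x\<Omega> xM by auto
      define n where "n = norm (x' - x)"
      define L where "L = riem_dist M x x'"
      have nL: "0 \<le> n" "n \<le> L" "L \<le> 2 * n" using dist[OF xM(1) x\<delta>(1) xM(2) x\<delta>(2)] by (auto simp: n_def L_def)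
      have n3: "n \<le> 2 * r3"
        using xb norm_triangle_ineq4[of "x' - xbar" "x - xbar"]
        by (simp add: n_def dist_norm norm_minus_commute)
      obtain c c' where c: "c 0 = x" "c 1 = x'" "continuous_on {-1<..<2} c'"
        and dc: "\<And>t. t \<in> {-1<..<2} \<Longrightarrow> (c has_vector_derivative c' t) (at t)"
        and cb: "\<And>t. t \<in> {-1<..<2} \<Longrightarrow> c t \<in> ball xbar \<epsilon>1"
        and cD: "\<And>t. t \<in> {0..1} \<Longrightarrow> H (c t) \<in> D"
        and c'_le: "\<And>t. t \<in> {0..1} \<Longrightarrow> norm (c' t - (x' - x)) \<le> \<epsilon>1 * n"
        using curve[OF x1 HD[OF x\<Omega>(1) xC(1)] HD[OF x\<Omega>(2) xC(2)]] unfolding n_def by metis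
      define \<gamma> where "\<gamma> t = P (c t)" for t
      define \<gamma>' where "\<gamma>' t = P' (c t) (c' t)" for t
      have c\<Omega>: "c t \<in> \<Omega>" "c t \<in> ball xbar r" if "t \<in> {-1<..<2}" for t
        using cb[OF that] ball\<Omega> \<Omega>D(1) by auto
      have d\<gamma>: "(\<gamma> has_vector_derivative \<gamma>' t) (at t)" if t: "t \<in> {-1<..<2}" for t
        using has_derivative_compose[OF dc[OF t, unfolded has_vector_derivative_def] deriv[OF c\<Omega>(2)[OF t]]]
        by (simp add: has_vector_derivative_def \<gamma>_def[abs_def] \<gamma>'_def blinfun.scaleR_right)
      have cont_c: "continuous_on {-1<..<2} c"
        using dc has_vector_derivative_continuous by (intro continuous_at_imp_continuous_on) blast
      have "continuous_on {-1<..<2} (\<lambda>t. P' (c t))"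
        by (rule continuous_on_compose2[OF continuous_deriv cont_c]) (use c\<Omega> in auto)
      then have cont_\<gamma>': "continuous_on {-1<..<2} \<gamma>'"
        unfolding \<gamma>'_def[abs_def] using c(3) by (intro continuous_intros)
      have "C1_on {-1<..<2} \<gamma>" unfolding C1_on_def
      proof (intro exI[of _ "\<lambda>t. blinfun_scaleR_left (\<gamma>' t)"] conjI ballI)
        show "(\<gamma> has_derivative blinfun_apply (blinfun_scaleR_left (\<gamma>' t))) (at t)" if "t \<in> {-1<..<2}" for t
          using d\<gamma>[OF that] by (simp add: has_vector_derivative_def)
        show "continuous_on {-1<..<2} (\<lambda>t. blinfun_scaleR_left (\<gamma>' t))"
          using cont_\<gamma>' by (intro continuous_intros)
      qed
      moreover have "\<gamma> t \<in> C" if t: "t \<in> {0..1}" for t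
        using H_iff[OF c\<Omega>(1), of t] cD[OF t] t by (simp add: \<gamma>_def)
      moreover have "{0..1} \<subseteq> {-1<..<(2::real)}" by auto
      ultimately have seg: "smooth_curve_segment C \<gamma>"
        unfolding smooth_curve_segment_def using open_greaterThanLessThan by blast
      have \<gamma>'_le: "norm (\<gamma>' t - (x' - x)) \<le> \<epsilon> / 2 * n" if t: "t \<in> {0..1}" for t
      proof -
        have tt: "t \<in> {-1<..<2}" using t by auto
        \<comment> \<open>Both end points are fixed by \<open>P\<close>, so this compares the chord
          with its image under \<open>P' (c t)\<close>; all points involved lie in a ball of radius
          \<open>\<epsilon>1\<close>.\<close>
        have "norm (P x' - P x - P' (c t) (x' - x)) \<le> K * (2 * \<epsilon>1) * norm (x' - x)"
        proof (rule increment_bound[of "ball xbar \<epsilon>1"])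
          show "norm (v - c t) \<le> 2 * \<epsilon>1" if "v \<in> ball xbar \<epsilon>1" for v
            using that cb[OF tt] norm_triangle_ineq4[of "v - xbar" "c t - xbar"]
            by (simp add: dist_norm norm_minus_commute)
        qed (use x\<epsilon> c\<Omega>[OF tt] ball\<Omega> \<Omega>D(1) in auto)
        then have 1: "norm (P' (c t) (x' - x) - (x' - x)) \<le> K * (2 * \<epsilon>1) * n"
          by (simp add: Px n_def norm_minus_commute)
        have "norm (P' (c t) (c' t - (x' - x))) \<le> norm (P' (c t)) * norm (c' t - (x' - x))"
          by (rule norm_blinfun)
        also have "\<dots> \<le> BP * (\<epsilon>1 * n)"
          using P'_le[OF c\<Omega>(2)[OF tt]] c'_le[OF t] BP by (intro mult_mono) auto
        finally have 2: "norm (P' (c t) (c' t - (x' - x))) \<le> BP * (\<epsilon>1 * n)" .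
        have "\<gamma>' t - (x' - x) = P' (c t) (c' t - (x' - x)) + (P' (c t) (x' - x) - (x' - x))"
          by (simp add: \<gamma>'_def blinfun.diff_right)
        also have "norm \<dots> \<le> BP * (\<epsilon>1 * n) + K * (2 * \<epsilon>1) * n"
          using 1 2 by (intro norm_triangle_le add_mono)
        also have "\<dots> = ((BP + 2 * K) * \<epsilon>1) * n" by (simp add: algebra_simps)
        also have "\<dots> \<le> \<epsilon> / 2 * n" using \<epsilon>1_le nL(1) by (rule mult_right_mono)
        finally show ?thesis .
      qed
      have "\<exists>v w. (\<gamma> has_vector_derivative v) (at t within {0..1}) \<and>
            (g has_vector_derivative w) (at t within {0..1}) \<and> norm (v - w) \<le> \<epsilon> * L"
        if g: "averaging_map M x x' g" and t: "t \<in> {0..1}" for g t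
      proof -
        obtain w where w: "(g has_vector_derivative w) (at t within {0..1})"
          "norm (w - (x' - x)) \<le> 8 * K * L\<^sup>2"
          using avg[OF xM(1) x\<delta>(1) xM(2) x\<delta>(2) neq g t] unfolding L_def by blast
        have "L \<le> 4 * r2" using nL n3 r3(5) by linarith
        then have "8 * K * L \<le> 8 * K * (4 * r2)" using K by (intro mult_left_mono) auto
        then have "8 * K * L \<le> \<epsilon> / 2" using r2(2) by linarith
        then have "8 * K * L * L \<le> \<epsilon> / 2 * L" using nL by (intro mult_right_mono) auto
        then have w2: "norm (w - (x' - x)) \<le> \<epsilon> / 2 * L" using w(2) by (simp add: power2_eq_square)
        \<comment> \<open>The chord \<open>n\<close> is at most the intrinsic distance
          \<open>L\<close>, which converts the bound into the required unit.\<close>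
        have "norm (\<gamma>' t - (x' - x)) \<le> \<epsilon> / 2 * L"
          using \<gamma>'_le[OF t] mult_left_mono[OF nL(2), of "\<epsilon> / 2"] \<epsilon> by linarith
        then have "norm (\<gamma>' t - w) \<le> \<epsilon> * L"
          using w2 norm_triangle_ineq4[of "\<gamma>' t - (x' - x)" "w - (x' - x)"] by simp
        moreover have "(\<gamma> has_vector_derivative \<gamma>' t) (at t within {0..1})"
          using t by (intro has_vector_derivative_at_within[OF d\<gamma>]) auto
        ultimately show ?thesis using w(1) by blast
      qed
      moreover have "\<gamma> 0 = x" "\<gamma> 1 = x'" by (auto simp: \<gamma>_def c Px)
      ultimately show "\<exists>\<gamma>. smooth_curve_segment C \<gamma> \<and> \<gamma> 0 = x \<and> \<gamma> 1 = x' \<and>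
              (\<forall>g. averaging_map M x x' g \<longrightarrow>
                 (\<forall>t\<in>{0..1}. \<exists>v w. (\<gamma> has_vector_derivative v) (at t within {0..1}) \<and>
                    (g has_vector_derivative w) (at t within {0..1}) \<and>
                    norm (v - w) \<le> \<epsilon> * riem_dist M x x'))"
        using seg unfolding L_def by blast
    qed (use r3 in auto)
  qed
qed

end
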